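(* Let $\alpha>1$ be a real algebraic number. Let $\eta$ be a real number such that $\widetilde{L}(\alpha)|\eta|<1$. Suppose that $\xi\notin\mathbb{Q}(\alpha)$ is a real number which is not Liouville over $\mathbb{Q}(\alpha)$. Then there exist $\delta_2\in(0,\frac{1}{2})$ depending only on $\alpha$ and $\eta$, and a constant $C=C(\alpha,\xi)>0$ depending only on $\alpha$ and $\xi$, such that $$\#\left\{1\leq n\leq N:\ \|\xi \alpha^{n}-\eta\|\geq\delta_2\right\}\geq \lfloor C\log N\rfloor$$ holds for all positive integers $N$.
   Context: For a real number $x$, $\|x\|$ denotes the distance from $x$ to its nearest integer. In the counting set, $n$ ranges over integers. For an algebraic number $\beta$, let $a_dx^d+a_{d-1}x^{d-1}+\cdots+a_1x+a_0\in\mathbb{Z}[x]$ be its minimal polynomial over $\mathbb{Z}$ (irreducible in $\mathbb{Z}[x]$, i.e. with coprime integer coefficients, of degree $d$), with roots $\beta_1=\beta,\beta_2,\ldots,\beta_d$ (the conjugates of $\beta$). Define $\widetilde{L}(\beta)=\left|\sum_{j=0}^d a_j\right|$, the Mahler measure $M(\beta)=|a_d|\prod_{i=1}^d\max\{1,|\beta_i|\}$, and the logarithmic height $h(\beta)=\frac1d\log M(\beta)$. A real number $\xi$ is said to be Liouville over a number field $\mathbb{K}$ if $\xi\notin\mathbb{K}$ and for any $\tau>0$ there exists $\beta\in\mathbb{K}$ with $h(\beta)>0$ such that $|\xi-\beta|<\exp(-\tau h(\beta))$. *)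

theory Defs
  imports Complex_Main "HOL-Computational_Algebra.Polynomial_Factorial"
    "Berlekamp_Zassenhaus.Mahler_Measure"
begin

text \<open>Irreducibility is meant in the ring of integer polynomials, so the coefficients are
  coprime. The sign of the leading coefficient only makes the polynomial unique; none of the
  quantities below depends on it.\<close>

definition min_int_poly :: "complex \<Rightarrow> int poly" where
  "min_int_poly \<beta> =
     (THE p. irreducible p \<and> lead_coeff p > 0 \<and> poly (map_poly of_int p) \<beta> = 0)"

definition L_tilde :: "complex \<Rightarrow> int" where
  "L_tilde \<beta> = \<bar>\<Sum>j\<le>degree (min_int_poly \<beta>). coeff (min_int_poly \<beta>) j\<bar>"

definition log_height :: "complex \<Rightarrow> real" where
  "log_height \<beta> = ln (mahler_measure (min_int_poly \<beta>)) / real (degree (min_int_poly \<beta>))"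

definition is_subfield :: "'a::field set \<Rightarrow> bool" where
  "is_subfield K \<longleftrightarrow> 0 \<in> K \<and> 1 \<in> K \<and> (\<forall>x\<in>K. \<forall>y\<in>K. x + y \<in> K \<and> x * y \<in> K) \<and>
     (\<forall>x\<in>K. - x \<in> K \<and> inverse x \<in> K)"

text \<open>A subfield of the complex numbers contains the rational numbers, so this is
  the field generated by the rationals and \<^term>\<open>a\<close>.\<close>

definition rat_adjoin :: "complex \<Rightarrow> complex set" where
  "rat_adjoin a = is_subfield hull {a}"

text \<open>Meant for number fields \<^term>\<open>K\<close>, viewed inside the complex numbers.\<close>

definition liouville_over :: "complex set \<Rightarrow> real \<Rightarrow> bool" where
  "liouville_over K \<xi> \<longleftrightarrow> complex_of_real \<xi> \<notin> K \<and>
     (\<forall>\<tau>>0. \<exists>\<beta>\<in>K. log_height \<beta> > 0 \<and>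
        cmod (complex_of_real \<xi> - \<beta>) < exp (- \<tau> * log_height \<beta>))"

definition dist_nearest_int :: "real \<Rightarrow> real" where
  "dist_nearest_int x = \<bar>x - of_int (round x)\<bar>"

end

theory Submission
  imports Defs "Berlekamp_Zassenhaus.Factor_Bound"
begin

text \<open>
  Let \<open>P\<close> be the minimal polynomial of \<open>\<alpha>\<close>, of degree \<open>d\<close>, and let \<open>u n\<close> be the integer nearest to
  \<open>\<xi> * \<alpha> ^ n - \<eta>\<close>. Applying the recurrence with characteristic polynomial \<open>P\<close> to \<open>u\<close> at the place
  \<open>n\<close> gives an integer. The sequence \<open>\<xi> * \<alpha> ^ n\<close> contributes nothing to it, the constant \<open>\<eta>\<close>
  contributes at most \<open>L_tilde \<alpha> * \<bar>\<eta>\<bar> < 1\<close>, and the rounding errors contribute little if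
  \<open>\<xi> * \<alpha> ^ k - \<eta>\<close> is close to an integer for \<open>k\<close> from \<open>n\<close> to \<open>n + d\<close>. So the integer vanishes, and
  throughout a block of indices with all distances below the threshold, \<open>u\<close> satisfies the recurrence
  (\<open>recurrence_of_near_shifted\<close>).

  Such a block cannot be long. If it extends from \<open>m\<close> to \<open>M\<close>, the coefficient of \<open>\<alpha> ^ n\<close> in the
  solution \<open>u\<close> is an element \<open>c\<close> of the field generated by \<open>\<alpha>\<close>. As \<open>\<xi> * \<alpha> ^ n - u n\<close> is bounded, the
  coefficient \<open>\<xi> - c\<close> of \<open>\<alpha> ^ n\<close> in this difference is at most a constant times \<open>\<alpha> ^ (- M)\<close>. On the other
  hand \<open>c\<close> depends only on \<open>d\<close> terms of \<open>u\<close> from the place \<open>m\<close> on, whose size is exponential in \<open>m\<close>, so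
  the height of \<open>c\<close> is at most linear in \<open>m\<close>, and since \<open>\<xi>\<close> is not Liouville, \<open>\<bar>\<xi> - c\<bar>\<close> is at
  least \<open>exp (- F * m)\<close> for some constant \<open>F\<close>. Hence \<open>M\<close> is at most a constant multiple of \<open>m\<close>
  (\<open>recurrence_breaks_in_geometric_blocks\<close>). So every interval from \<open>m + 1\<close> to \<open>B * m\<close> contains an index
  with distance at least the threshold, and counting the blocks between consecutive powers of \<open>B\<close>
  gives the logarithm (\<open>card_ge_log_of_geometric_blocks\<close>).

  To extract the coefficient \<open>c\<close>, the polynomial \<open>P / (X - \<alpha>)\<close> is evaluated at the shift; this
  annihilates the components of \<open>u\<close> along the other conjugates of \<open>\<alpha>\<close> (\<open>alpha_part\<close>). The height of
  \<open>c\<close>, a quotient of two integer polynomials in \<open>\<alpha>\<close>, is bounded by producing an annihilating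
  polynomial with small integer coefficients from Siegel's lemma
  (\<open>small_annihilating_poly_of_quotient\<close>) and applying Landau's inequality to it; the minimal
  polynomial of \<open>c\<close> divides it and so has no larger Mahler measure (\<open>log_height_quotient_le\<close>).
\<close>

section \<open>Minimal polynomials and heights\<close>

abbreviation ipoly :: "int poly \<Rightarrow> complex \<Rightarrow> complex" where
  "ipoly p x \<equiv> poly (map_poly of_int p) x"

lemma degree_pos_of_root:
  assumes "p \<noteq> 0" "ipoly p x = 0" shows "degree p > 0"
proof (rule ccontr)
  assume "\<not> degree p > 0"
  then obtain a where "p = [:a:]" by (metis degree_eq_zeroE neq0_conv)
  with assms show False by simp
qed

text \<open>Let \<open>r\<close> be a nonzero integer polynomial of least degree that vanishes at \<open>x\<close>. Pseudo-division by
  \<open>r\<close> leaves remainder zero on both \<open>p\<close> and \<open>q\<close>, so up to constants both are multiples of \<open>r\<close>; since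
  \<open>p\<close> is prime of positive degree, it divides \<open>r\<close> and hence \<open>q\<close>.\<close>

lemma irreducible_dvd_if_common_root:
  assumes irr: "irreducible p" and px: "ipoly p x = 0" and qx: "ipoly q x = 0"
  shows "p dvd q"
proof -
  have p0: "p \<noteq> 0" using irr by auto
  have dp: "degree p > 0" using degree_pos_of_root[OF p0 px] .
  have prime: "prime_elem p" using irr by (rule irreducible_imp_prime_elem)
  define S where "S = (\<lambda>r. r \<noteq> 0 \<and> ipoly r x = 0)"
  obtain r where r: "S r" and rmin: "\<And>t. S t \<Longrightarrow> degree r \<le> degree t"
    using ex_has_least_nat[of S p degree] p0 px unfolding S_def by blast
  have r0: "r \<noteq> 0" and rx: "ipoly r x = 0" using r by (auto simp: S_def)
  have div: "\<exists>c s. c \<noteq> 0 \<and> smult c t = r * s" if tx: "ipoly t x = 0" for t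
  proof -
    obtain c s where cs: "c \<noteq> 0" "smult c t = r * s + pseudo_mod t r"
      using pseudo_mod(1)[OF r0, of t] by auto
    have "ipoly (smult c t) x = ipoly (r * s + pseudo_mod t r) x" by (simp only: cs(2))
    hence "ipoly (pseudo_mod t r) x = 0" using tx rx
      by (simp add: of_int_poly_hom.hom_add of_int_poly_hom.hom_mult of_int_hom.map_poly_hom_smult)
    moreover have "pseudo_mod t r = 0 \<or> degree (pseudo_mod t r) < degree r"
      using pseudo_mod(2)[OF r0] .
    ultimately have "pseudo_mod t r = 0" using rmin unfolding S_def by (meson leD)
    with cs show ?thesis by auto
  qed
  obtain c s where c: "c \<noteq> 0" and cs: "smult c p = r * s" using div[OF px] by blast
  have "p dvd r"
  proof (rule ccontr)
    \<comment> \<open>Otherwise \<open>p\<close> divides the cofactor \<open>s\<close>, so \<open>r\<close> divides a constant and cannot have a root.\<close>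
    assume nd: "\<not> p dvd r"
    have "p dvd r * s" unfolding cs[symmetric] by (simp add: dvd_smult)
    with nd have "p dvd s" using prime by (simp add: prime_elem_dvd_mult_iff)
    then obtain s' where "s = p * s'" by blast
    with cs have "p * [:c:] = p * (r * s')" by (simp add: ac_simps)
    hence "[:c:] = r * s'" using p0 by (simp only: mult_cancel_left) simp
    hence "degree (r * s') = 0" and "s' \<noteq> 0" using c
      by (metis degree_pCons_0, auto)
    hence "degree r = 0" using r0 by (simp add: degree_mult_eq)
    thus False using degree_pos_of_root[OF r0 rx] by simp
  qed
  obtain c' s' where c': "c' \<noteq> 0" and cs': "smult c' q = r * s'" using div[OF qx] by blast
  have "p dvd [:c':] * q" using cs' \<open>p dvd r\<close> by simp
  hence "p dvd [:c':] \<or> p dvd q" by (rule prime_elem_dvd_multD[OF prime])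
  moreover have "\<not> p dvd [:c':]"
    using dvd_imp_degree_le[of p "[:c':]"] c' dp by auto
  ultimately show "p dvd q" by simp
qed

lemma ipoly_prod_mset_eq_0:
  "ipoly (prod_mset A) x = 0 \<Longrightarrow> \<exists>p \<in># A. ipoly p x = 0"
proof (induction A)
  case (add p A)
  have "ipoly (prod_mset (add_mset p A)) x = ipoly p x * ipoly (prod_mset A) x"
    by (simp only: prod_mset.add_mset of_int_poly_hom.hom_mult poly_mult)
  with add show ?case by auto
qed simp

text \<open>These are the properties that the definite description in the definition promises: some
  irreducible factor of \<open>q\<close> vanishes at \<open>x\<close>, and two such factors divide each other, so they agree up
  to a sign.\<close>

lemma min_int_poly:
  assumes q0: "q \<noteq> 0" and qx: "ipoly q x = 0"
  shows "irreducible (min_int_poly x)" "lead_coeff (min_int_poly x) > 0"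
    "ipoly (min_int_poly x) x = 0"
proof -
  let ?P = "\<lambda>p. irreducible p \<and> lead_coeff p > 0 \<and> ipoly p x = 0"
  have "\<exists>p. ?P p"
  proof -
    have "q dvd prod_mset (prime_factorization q)"
      using prod_mset_prime_factorization_weak[OF q0] by (metis associatedD2 dvd_refl)
    then obtain k where k: "prod_mset (prime_factorization q) = q * k" by blast
    have "ipoly (prod_mset (prime_factorization q)) x = 0"
      unfolding k using qx by (simp add: of_int_poly_hom.hom_mult)
    hence "\<exists>p \<in># prime_factorization q. ipoly p x = 0"
      by (rule ipoly_prod_mset_eq_0)
    then obtain p where p: "p \<in># prime_factorization q" "ipoly p x = 0" by blast
    hence irr: "irreducible p" by (meson in_prime_factors_imp_prime prime_elem_imp_irreducible prime_imp_prime_elem)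
    show ?thesis
    proof (cases "lead_coeff p > 0")
      case True
      with irr p show ?thesis by blast
    next
      case False
      have "irreducible (- p)" using irr by (simp add: irreducible_altdef)
      moreover have "lead_coeff (- p) > 0" using False irr
        using leading_coeff_0_iff[of p] by (cases "p = 0") auto
      moreover have "ipoly (- p) x = 0" using p by (simp add: of_int_poly_hom.hom_uminus)
      ultimately show ?thesis by blast
    qed
  qed
  moreover have "p = q" if p: "?P p" and q: "?P q" for p q
  proof -
    have "p dvd q" using irreducible_dvd_if_common_root[of p x q] p q by blast
    moreover have "q dvd p" using irreducible_dvd_if_common_root[of q x p] p q by blast
    ultimately obtain k l where k: "q = p * k" and "p = q * l" by (elim dvdE)
    hence "p * 1 = p * (k * l)" by (simp add: ac_simps)
    moreover have "p \<noteq> 0" using p by auto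
    ultimately have "1 = k * l" by (simp only: mult_cancel_left) simp
    hence "is_unit k" by (rule dvdI)
    then obtain e where "k = [:e:]" "e dvd 1" by (auto simp: is_unit_poly_iff)
    moreover have "lead_coeff q = lead_coeff p * lead_coeff k" using k by (simp add: lead_coeff_mult)
    ultimately have "e > 0" "e dvd 1" using p q by (auto simp: zero_less_mult_iff)
    hence "e = 1" by simp
    with k \<open>k = [:e:]\<close> show ?thesis by simp
  qed
  ultimately have "\<exists>!p. ?P p" by (rule ex_ex1I)
  from theI'[OF this] show "irreducible (min_int_poly x)" "lead_coeff (min_int_poly x) > 0"
    "ipoly (min_int_poly x) x = 0" unfolding min_int_poly_def by auto
qed

lemma min_int_poly_dvd:
  assumes "q \<noteq> 0" "ipoly q x = 0"
  shows "min_int_poly x dvd q"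
  by (rule irreducible_dvd_if_common_root[OF min_int_poly(1,3)[OF assms] assms(2)])

lemma algebraic_int_poly:
  assumes "algebraic (y::real)"
  obtains q where "q \<noteq> 0" "ipoly q (of_real y) = 0"
proof -
  obtain q where q: "\<And>i. coeff q i \<in> \<int>" "q \<noteq> 0" "poly q y = 0" using assms by (rule algebraicE) blast
  obtain r where r: "q = map_poly of_int r"
  proof
    show "q = map_poly of_int (map_poly floor q)"
    proof (rule poly_eqI)
      fix i
      have "coeff (map_poly of_int (map_poly floor q)) i = real_of_int \<lfloor>coeff q i\<rfloor>"
        by (simp add: coeff_map_poly)
      also have "\<dots> = coeff q i" using q(1)[of i] by (metis Ints_cases floor_of_int)
      finally show "coeff q i = coeff (map_poly of_int (map_poly floor q)) i" by (rule sym)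
    qed
  qed
  have "r \<noteq> 0" using q(2) r by auto
  moreover have "poly (map_poly of_real q) (complex_of_real y) = 0" using q(3) by simp
  hence "ipoly r (of_real y) = 0" unfolding r by (subst (asm) map_poly_map_poly) (auto simp: o_def)
  ultimately show ?thesis by (rule that)
qed

text \<open>The minimal polynomial divides \<open>q\<close>, and the Mahler measure is multiplicative and at least 1
  on nonzero integer polynomials.\<close>

lemma log_height_le_ln_mahler_measure:
  assumes "q \<noteq> 0" "ipoly q x = 0"
  shows "log_height x \<le> ln (mahler_measure q)"
proof -
  let ?p = "min_int_poly x"
  have p0: "?p \<noteq> 0" and px: "ipoly ?p x = 0" using min_int_poly[OF assms] by auto
  have "degree ?p \<ge> 1" using degree_pos_of_root[OF p0 px] by simp
  moreover have ge: "mahler_measure ?p \<ge> 1" using mahler_measure_poly_ge_1[OF p0] .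
  ultimately have "log_height x \<le> ln (mahler_measure ?p) / 1"
    unfolding log_height_def by (intro divide_left_mono) auto
  also have "\<dots> \<le> ln (mahler_measure q)"
    using mahler_measure_dvd[OF assms(1) min_int_poly_dvd[OF assms]] ge by simp
  finally show ?thesis .
qed

text \<open>Landau's inequality, with the Euclidean norm replaced by the larger sum of absolute values.\<close>

lemma mahler_measure_le_sum_abs_coeffs: "mahler_measure f \<le> (\<Sum>i\<le>degree f. \<bar>real_of_int (coeff f i)\<bar>)"
proof -
  have "real_of_int (\<Sum>a\<leftarrow>coeffs f. a * a) = (\<Sum>i\<le>degree f. \<bar>real_of_int (coeff f i)\<bar>\<^sup>2)"
  proof (cases "f = 0")
    case False
    have "(\<Sum>a\<leftarrow>coeffs f. a * a) = sum_list (map (\<lambda>i. coeff f i * coeff f i) [0..<Suc (degree f)])"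
      using False by (simp add: coeffs_def o_def)
    also have "\<dots> = (\<Sum>i\<in>{0..<Suc (degree f)}. coeff f i * coeff f i)"
      by (simp only: interv_sum_list_conv_sum_set_nat set_upt)
    also have "{0..<Suc (degree f)} = {..degree f}" by auto
    finally show ?thesis by (simp only: of_int_sum of_int_mult power2_eq_square abs_mult_self_eq)
  qed simp
  moreover have "sqrt (\<Sum>i\<le>degree f. \<bar>real_of_int (coeff f i)\<bar>\<^sup>2) \<le> (\<Sum>i\<le>degree f. \<bar>real_of_int (coeff f i)\<bar>)"
    (is "sqrt ?A \<le> ?S")
  proof (rule real_le_lsqrt)
    have "?A \<le> (\<Sum>i\<le>degree f. \<bar>real_of_int (coeff f i)\<bar> * ?S)"
      unfolding power2_eq_square by (intro sum_mono mult_left_mono member_le_sum) auto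
    thus "?A \<le> ?S\<^sup>2" by (simp add: sum_distrib_right power2_eq_square)
  qed (simp add: sum_nonneg)
  ultimately show ?thesis using Landau_inequality_mahler_measure[of f] by simp
qed

text \<open>Northcott's finiteness property for height zero. Mignotte's bound confines the coefficients of
  the minimal polynomial to a finite range, so only finitely many minimal polynomials occur.\<close>

lemma finite_roots_log_height_nonpos:
  "finite {x. \<exists>q. q \<noteq> 0 \<and> degree q \<le> d \<and> ipoly q x = 0 \<and> log_height x \<le> 0}"
proof -
  define B where "B = {p :: int poly. degree p \<le> d \<and> (\<forall>i. \<bar>coeff p i\<bar> \<le> 2 ^ d)}"
  have "B \<subseteq> Poly ` {xs. set xs \<subseteq> {- (2 ^ d)..2 ^ d} \<and> length xs \<le> Suc d}"
  proof
    fix p assume p: "p \<in> B"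
    have "c \<in> {- (2 ^ d)..2 ^ d}" if "c \<in> set (coeffs p)" for c
    proof -
      have "c \<in> range (coeff p)" using that by (simp add: range_coeff)
      then obtain i where "c = coeff p i" by (elim rangeE)
      moreover have "\<bar>coeff p i\<bar> \<le> 2 ^ d" using p by (simp add: B_def)
      ultimately show ?thesis by (simp add: abs_le_iff)
    qed
    moreover have "length (coeffs p) \<le> Suc d"
      using p by (cases "p = 0") (simp_all add: B_def length_coeffs)
    ultimately show "p \<in> Poly ` {xs. set xs \<subseteq> {- (2 ^ d)..2 ^ d} \<and> length xs \<le> Suc d}"
      by (intro image_eqI[of _ _ "coeffs p"]) auto
  qed
  moreover have "finite {xs :: int list. set xs \<subseteq> {- (2 ^ d)..2 ^ d} \<and> length xs \<le> Suc d}"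
    by (rule finite_lists_length_le) simp
  ultimately have "finite B" by (rule finite_surj[rotated])
  hence "finite (\<Union>p\<in>B - {0}. {x. ipoly p x = 0})"
    by (intro finite_UN_I finite_Diff poly_roots_finite) simp_all
  thus ?thesis
  proof (rule finite_subset[rotated], safe)
    fix x q assume q: "q \<noteq> 0" "degree q \<le> d" "ipoly q x = 0" "log_height x \<le> 0"
    let ?p = "min_int_poly x"
    have p0: "?p \<noteq> 0" and px: "ipoly ?p x = 0" using min_int_poly[OF q(1,3)] by auto
    have dp: "degree ?p > 0" using degree_pos_of_root[OF p0 px] .
    have "mahler_measure ?p \<ge> 1" using mahler_measure_poly_ge_1[OF p0] .
    moreover have "ln (mahler_measure ?p) \<le> 0"
      using q(4) dp by (simp add: log_height_def divide_le_0_iff)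
    ultimately have M: "mahler_measure ?p \<le> 1" by simp
    have deg: "degree ?p \<le> d"
      using dvd_imp_degree_le[OF min_int_poly_dvd[OF q(1,3)] q(1)] q(2) by simp
    have "\<bar>coeff ?p i\<bar> \<le> 2 ^ d" for i
    proof -
      have "real_of_int \<bar>coeff ?p i\<bar> \<le> real (degree ?p choose i) * mahler_measure ?p"
        using Mignotte_bound[of ?p i] by simp
      also have "\<dots> \<le> real (degree ?p choose i) * 1" by (intro mult_left_mono M) auto
      also have "\<dots> \<le> real (2 ^ degree ?p)" using binomial_le_pow2[of "degree ?p" i] by (simp only: mult_1_right of_nat_le_iff)
      also have "\<dots> \<le> 2 ^ d" using deg by (simp add: power_increasing)
      finally have "real_of_int \<bar>coeff ?p i\<bar> \<le> real_of_int (2 ^ d)" by simp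
      thus ?thesis by (simp only: of_int_le_iff)
    qed
    thus "x \<in> (\<Union>p\<in>B - {0}. {x. ipoly p x = 0})" using deg p0 px by (auto simp: B_def)
  qed
qed

section \<open>Siegel's lemma\<close>

text \<open>Siegel's lemma for \<open>d\<close> equations in \<open>d + 1\<close> unknowns: the vectors with entries in
  \<open>{0..h}\<close> outnumber the possible values of the linear map, so two of them have the same image, and
  their difference is a solution.\<close>

lemma small_integer_kernel_vector:
  fixes s :: "nat \<Rightarrow> nat \<Rightarrow> int" and t d :: nat
  assumes t: "t \<ge> 1" and s: "\<And>i j. i \<le> d \<Longrightarrow> j < d \<Longrightarrow> \<bar>s i j\<bar> \<le> int t"
  obtains q :: "nat \<Rightarrow> int"
  where "\<exists>i\<le>d. q i \<noteq> 0" "\<And>i. \<bar>q i\<bar> \<le> int ((2 * (d + 1) * t) ^ d)"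
    "\<And>j. j < d \<Longrightarrow> (\<Sum>i\<le>d. q i * s i j) = 0"
proof -
  \<comment> \<open>The choice \<open>h = c ^ d\<close> makes \<open>(c * (h + 1)) ^ d < (h + 1) ^ (d + 1)\<close>, which is the counting inequality.\<close>
  define c where "c = 2 * (d + 1) * t"
  define h where "h = c ^ d"
  define b where "b = (d + 1) * h * t"
  define A where "A = {..d} \<rightarrow>\<^sub>E {0..int h}"
  define B where "B = {..<d} \<rightarrow>\<^sub>E {- int b..int b}"
  define f where "f = (\<lambda>q :: nat \<Rightarrow> int. \<lambda>j\<in>{..<d}. \<Sum>i\<le>d. q i * s i j)"
  have fin: "finite B" unfolding B_def by (intro finite_PiE) auto
  have "f ` A \<subseteq> B"
  proof (rule image_subsetI)
    fix q assume q: "q \<in> A"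
    have "\<bar>\<Sum>i\<le>d. q i * s i j\<bar> \<le> int b" if j: "j < d" for j
    proof -
      have "\<bar>\<Sum>i\<le>d. q i * s i j\<bar> \<le> (\<Sum>i\<le>d. \<bar>q i * s i j\<bar>)" by (rule sum_abs)
      also have "\<dots> \<le> (\<Sum>i\<le>d. int h * int t)"
      proof (rule sum_mono)
        fix i assume i: "i \<in> {..d}"
        have "q i \<in> {0..int h}" using q i unfolding A_def by (rule PiE_mem)
        thus "\<bar>q i * s i j\<bar> \<le> int h * int t"
          using s[of i j] i j by (auto simp: abs_mult intro!: mult_mono)
      qed
      also have "\<dots> = int b" by (simp add: b_def algebra_simps)
      finally show ?thesis .
    qed
    thus "f q \<in> B" by (auto simp: f_def B_def abs_le_iff minus_le_iff)
  qed
  moreover have "card B < card A"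
  proof -
    have "card {- int b..int b} = 2 * b + 1" unfolding card_atLeastAtMost_int by linarith
    hence "card B = (2 * b + 1) ^ d" unfolding B_def by (simp only: card_PiE finite_lessThan prod_constant card_lessThan)
    also have "2 * b + 1 \<le> c * (h + 1)"
      using t by (simp add: b_def c_def algebra_simps)
    hence "(2 * b + 1) ^ d \<le> (c * (h + 1)) ^ d" by (rule power_mono) simp
    also have "\<dots> = h * (h + 1) ^ d" by (simp only: power_mult_distrib h_def)
    also have "\<dots> < (h + 1) ^ Suc d" by simp
    also have "\<dots> = card A"
      unfolding A_def by (simp add: card_PiE nat_add_distrib)
    finally show ?thesis .
  qed
  ultimately have "\<not> inj_on f A" using card_inj_on_le[of f A B] fin by linarith
  then obtain q r where qr: "q \<in> A" "r \<in> A" "f q = f r" "q \<noteq> r" unfolding inj_on_def by blast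
  define u where "u = (\<lambda>i. if i \<le> d then q i - r i else 0)"
  show thesis
  proof (rule that[of u])
    show "\<exists>i\<le>d. u i \<noteq> 0"
    proof (rule ccontr)
      assume "\<not> (\<exists>i\<le>d. u i \<noteq> 0)"
      hence "q i = r i" if "i \<in> {..d}" for i using that by (auto simp: u_def)
      with qr(1,2) have "q = r" unfolding A_def by (intro PiE_ext)
      with qr(4) show False by simp
    qed
    show "\<bar>u i\<bar> \<le> int ((2 * (d + 1) * t) ^ d)" for i
    proof (cases "i \<le> d")
      case True
      hence "q i \<in> {0..int h}" "r i \<in> {0..int h}" using qr(1,2) unfolding A_def by (auto intro: PiE_mem)
      thus ?thesis using True unfolding u_def h_def c_def[symmetric] by auto
    qed (simp add: u_def)
    show "(\<Sum>i\<le>d. u i * s i j) = 0" if j: "j < d" for j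
    proof -
      have "f q j = f r j" using qr(3) by simp
      hence "(\<Sum>i\<le>d. q i * s i j) = (\<Sum>i\<le>d. r i * s i j)" using j by (simp add: f_def)
      thus ?thesis by (simp add: u_def left_diff_distrib sum_subtractf)
    qed
  qed
qed

section \<open>Heights of quotients in the field generated by an algebraic number\<close>

text \<open>Elements of the lattice spanned by the first \<open>d\<close> powers of \<open>\<alpha>\<close>, graded by the size of their
  coordinates. The bounds on coordinates are what later becomes a bound on heights.\<close>

definition int_span :: "nat \<Rightarrow> complex \<Rightarrow> nat \<Rightarrow> complex set" where
  "int_span d \<alpha> X = {z. \<exists>s :: nat \<Rightarrow> int. (\<forall>j<d. \<bar>s j\<bar> \<le> int X) \<and> z = (\<Sum>j<d. of_int (s j) * \<alpha> ^ j)}"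

lemma int_spanI:
  "(\<And>j. j < d \<Longrightarrow> \<bar>s j\<bar> \<le> int X) \<Longrightarrow> z = (\<Sum>j<d. of_int (s j) * \<alpha> ^ j) \<Longrightarrow> z \<in> int_span d \<alpha> X"
  unfolding int_span_def by blast

lemma int_span_mono:
  assumes "X \<le> Y" "z \<in> int_span d \<alpha> X" shows "z \<in> int_span d \<alpha> Y"
proof -
  have "\<bar>c\<bar> \<le> int Y" if "\<bar>c\<bar> \<le> int X" for c using that assms(1) by linarith
  thus ?thesis using assms(2) unfolding int_span_def by blast
qed

lemma int_span_sum:
  assumes fin: "finite I" and c: "\<And>i. i \<in> I \<Longrightarrow> \<bar>c i\<bar> \<le> int C"
    and z: "\<And>i. i \<in> I \<Longrightarrow> z i \<in> int_span d \<alpha> X"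
  shows "(\<Sum>i\<in>I. of_int (c i) * z i) \<in> int_span d \<alpha> (card I * C * X)"
proof -
  have "\<forall>i\<in>I. \<exists>s. (\<forall>j<d. \<bar>s j\<bar> \<le> int X) \<and> z i = (\<Sum>j<d. of_int (s j) * \<alpha> ^ j)"
    using z unfolding int_span_def by blast
  then obtain s where s: "\<And>i j. i \<in> I \<Longrightarrow> j < d \<Longrightarrow> \<bar>s i j\<bar> \<le> int X"
    and zs: "\<And>i. i \<in> I \<Longrightarrow> z i = (\<Sum>j<d. of_int (s i j) * \<alpha> ^ j)" by metis
  show ?thesis
  proof (rule int_spanI[of _ "\<lambda>j. \<Sum>i\<in>I. c i * s i j"])
    fix j assume j: "j < d"
    have "\<bar>\<Sum>i\<in>I. c i * s i j\<bar> \<le> (\<Sum>i\<in>I. \<bar>c i * s i j\<bar>)" by (rule sum_abs)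
    also have "\<dots> \<le> (\<Sum>i\<in>I. int C * int X)"
      by (intro sum_mono) (auto simp: abs_mult intro!: mult_mono c s j)
    also have "\<dots> = int (card I * C * X)" by simp
    finally show "\<bar>\<Sum>i\<in>I. c i * s i j\<bar> \<le> int (card I * C * X)" .
  next
    have "(\<Sum>i\<in>I. of_int (c i) * z i) = (\<Sum>i\<in>I. \<Sum>j<d. of_int (c i) * (of_int (s i j) * \<alpha> ^ j))"
      using zs by (simp add: sum_distrib_left)
    also have "\<dots> = (\<Sum>j<d. \<Sum>i\<in>I. of_int (c i) * (of_int (s i j) * \<alpha> ^ j))" by (rule sum.swap)
    also have "\<dots> = (\<Sum>j<d. of_int (\<Sum>i\<in>I. c i * s i j) * \<alpha> ^ j)"
      by (simp add: sum_distrib_right mult.assoc)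
    finally show "(\<Sum>i\<in>I. of_int (c i) * z i) = (\<Sum>j<d. of_int (\<Sum>i\<in>I. c i * s i j) * \<alpha> ^ j)" .
  qed
qed

lemma int_span_of_int_mult:
  assumes "z \<in> int_span d \<alpha> X" "\<bar>c\<bar> \<le> int C"
  shows "of_int c * z \<in> int_span d \<alpha> (C * X)"
  using int_span_sum[of "{()}" "\<lambda>_. c" C "\<lambda>_. z"] assms by simp

lemma int_span_power:
  assumes "k < d" shows "\<alpha> ^ k \<in> int_span d \<alpha> 1"
  by (rule int_spanI[of _ "\<lambda>j. if j = k then 1 else 0"])
     (use assms in \<open>auto simp: if_distrib[of of_int] if_distrib[of "\<lambda>x. x * _"] sum.delta cong: if_cong\<close>)

definition length_poly :: "int poly \<Rightarrow> nat" where
  "length_poly p = (\<Sum>j\<le>degree p. nat \<bar>coeff p j\<bar>)"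

lemma length_poly_pos: "p \<noteq> 0 \<Longrightarrow> length_poly p \<ge> 1"
proof -
  assume "p \<noteq> 0"
  hence "1 \<le> nat \<bar>coeff p (degree p)\<bar>" by (simp add: Suc_le_eq)
  also have "\<dots> \<le> length_poly p" unfolding length_poly_def by (rule member_le_sum) auto
  finally show ?thesis .
qed

locale algebraic_root =
  fixes P :: "int poly" and \<alpha> :: complex
  assumes P0: "P \<noteq> 0" and root: "ipoly P \<alpha> = 0"
begin

abbreviation "d \<equiv> degree P"
abbreviation "a \<equiv> lead_coeff P"
abbreviation "L \<equiv> length_poly P"

lemma d_pos: "d \<ge> 1" using degree_pos_of_root[OF P0 root] by simp

lemma root_sum: "(\<Sum>j\<le>d. of_int (coeff P j) * \<alpha> ^ j) = 0"
  using root by (simp add: poly_altdef)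

lemma coeffs_le_length:
  assumes "j < d" shows "\<bar>a\<bar> + \<bar>coeff P j\<bar> \<le> int L"
proof -
  have "(\<Sum>i\<in>{d, j}. nat \<bar>coeff P i\<bar>) \<le> L" 
    unfolding length_poly_def by (rule sum_mono2) (use assms in auto)
  thus ?thesis using assms by simp
qed

lemma lead_le_length: "\<bar>a\<bar> \<le> int L"
  using coeffs_le_length[of 0] d_pos by simp

text \<open>Multiplication by the leading coefficient times \<open>\<alpha>\<close> maps the lattice into itself, because
  the only power that leaves the range can be rewritten with the equation for \<open>\<alpha>\<close>; coordinates grow
  at most by the factor \<open>L\<close>.\<close>

lemma int_span_shift:
  assumes z: "z \<in> int_span d \<alpha> X"
  shows "of_int a * \<alpha> * z \<in> int_span d \<alpha> (L * X)"
proof -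
  obtain s where s: "\<And>j. j < d \<Longrightarrow> \<bar>s j\<bar> \<le> int X" and zs: "z = (\<Sum>j<d. of_int (s j) * \<alpha> ^ j)"
    using z unfolding int_span_def by blast
  obtain e where e: "d = Suc e" using d_pos by (cases d) auto
  define t where "t = (\<lambda>j. (case j of 0 \<Rightarrow> 0 | Suc i \<Rightarrow> a * s i) - s e * coeff P j)"
  show ?thesis
  proof (rule int_spanI[of _ t])
    fix j assume j: "j < d"
    have "\<bar>t j\<bar> \<le> \<bar>a\<bar> * int X + \<bar>coeff P j\<bar> * int X"
    proof -
      have "\<bar>case j of 0 \<Rightarrow> 0 | Suc i \<Rightarrow> a * s i\<bar> \<le> \<bar>a\<bar> * int X"
        using j by (cases j) (auto simp: abs_mult intro!: mult_left_mono s)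
      moreover have "\<bar>s e * coeff P j\<bar> \<le> \<bar>coeff P j\<bar> * int X"
        using mult_left_mono[OF s[of e], of "\<bar>coeff P j\<bar>"] e by (simp add: abs_mult mult.commute)
      ultimately show ?thesis unfolding t_def by linarith
    qed
    also have "\<dots> = (\<bar>a\<bar> + \<bar>coeff P j\<bar>) * int X" by (simp add: algebra_simps)
    also have "\<dots> \<le> int (L * X)" using mult_right_mono[OF coeffs_le_length[OF j], of "int X"] by simp
    finally show "\<bar>t j\<bar> \<le> int (L * X)" .
  next
    have "of_int a * \<alpha> ^ Suc e = - (\<Sum>j<Suc e. of_int (coeff P j) * \<alpha> ^ j)"
    proof -
      have "{..d} = insert (Suc e) {..<Suc e}" unfolding e by auto
      thus ?thesis using root_sum by (simp add: e eq_neg_iff_add_eq_0 del: sum.lessThan_Suc)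
    qed
    hence red: "of_int (s e) * (of_int a * \<alpha> ^ Suc e)
        = - (\<Sum>j<Suc e. of_int (s e * coeff P j) * \<alpha> ^ j)"
      by (simp only: sum_distrib_left mult_minus_right of_int_mult mult.assoc)
    have "of_int a * \<alpha> * z = (\<Sum>j<e. of_int (a * s j) * \<alpha> ^ Suc j) + of_int (s e) * (of_int a * \<alpha> ^ Suc e)"
      unfolding zs e by (simp add: sum_distrib_left algebra_simps)
    also have "(\<Sum>j<e. of_int (a * s j) * \<alpha> ^ Suc j)
        = (\<Sum>j<Suc e. of_int (case j of 0 \<Rightarrow> 0 | Suc i \<Rightarrow> a * s i) * \<alpha> ^ j)"
      by (simp add: sum.lessThan_Suc_shift del: sum.lessThan_Suc)
    also have "\<dots> + of_int (s e) * (of_int a * \<alpha> ^ Suc e) = (\<Sum>j<Suc e. of_int (t j) * \<alpha> ^ j)"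
      unfolding red t_def of_int_diff left_diff_distrib sum_subtractf by (simp only: diff_conv_add_uminus)
    finally show "of_int a * \<alpha> * z = (\<Sum>j<d. of_int (t j) * \<alpha> ^ j)" unfolding e .
  qed
qed

lemma int_span_shift_power:
  assumes z: "z \<in> int_span d \<alpha> X"
  shows "of_int a ^ k * \<alpha> ^ k * z \<in> int_span d \<alpha> (L ^ k * X)"
proof (induction k)
  case (Suc k)
  from int_span_shift[OF Suc] show ?case by (simp add: ac_simps)
qed (use z in simp)

text \<open>The lattice is not closed under multiplication unless \<open>\<alpha>\<close> is an algebraic integer; the
  factor \<open>a ^ d\<close> clears all denominators that the reduction of \<open>\<alpha> ^ j * w\<close> with \<open>j < d\<close> can produce.\<close>

lemma int_span_mult:
  assumes z: "z \<in> int_span d \<alpha> X" and w: "w \<in> int_span d \<alpha> Y"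
  shows "of_int a ^ d * z * w \<in> int_span d \<alpha> (d * L ^ d * X * Y)"
proof -
  obtain s where s: "\<And>j. j < d \<Longrightarrow> \<bar>s j\<bar> \<le> int X" and zs: "z = (\<Sum>j<d. of_int (s j) * \<alpha> ^ j)"
    using z unfolding int_span_def by blast
  have "of_int a ^ d * \<alpha> ^ j * w \<in> int_span d \<alpha> (L ^ d * Y)" if j: "j < d" for j
  proof -
    have "\<bar>a ^ (d - j)\<bar> \<le> int (L ^ (d - j))"
      using power_mono[OF lead_le_length, of "d - j"] by (simp add: power_abs)
    hence "of_int (a ^ (d - j)) * (of_int a ^ j * \<alpha> ^ j * w) \<in> int_span d \<alpha> (L ^ (d - j) * (L ^ j * Y))"
      by (intro int_span_of_int_mult int_span_shift_power w)
    moreover have "of_int (a ^ (d - j)) * (of_int a ^ j * \<alpha> ^ j * w) = of_int a ^ d * \<alpha> ^ j * w"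
      "L ^ (d - j) * (L ^ j * Y) = L ^ d * Y"
      using j by (simp_all flip: power_add mult.assoc)
    ultimately show ?thesis by (simp only:)
  qed
  hence "(\<Sum>j<d. of_int (s j) * (of_int a ^ d * \<alpha> ^ j * w)) \<in> int_span d \<alpha> (card {..<d} * X * (L ^ d * Y))"
    by (intro int_span_sum) (auto intro: s)
  thus ?thesis by (simp add: zs sum_distrib_left sum_distrib_right ac_simps)
qed

definition mult_const :: nat where "mult_const = d * L ^ d"

lemma int_span_power_mult:
  assumes N: "N \<in> int_span d \<alpha> X" and D: "D \<in> int_span d \<alpha> X"
  shows "(of_int a ^ d) ^ (p + q) * D ^ p * N ^ q \<in> int_span d \<alpha> ((mult_const * X) ^ (p + q))"
proof (induction p)
  case 0
  show ?case
  proof (induction q)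
    case 0
    show ?case using int_span_power[of 0 d \<alpha>] d_pos by simp
  next
    case (Suc q)
    from int_span_mult[OF N Suc] show ?case by (simp add: ac_simps mult_const_def)
  qed
next
  case (Suc p)
  from int_span_mult[OF D Suc] show ?case by (simp add: ac_simps mult_const_def)
qed

text \<open>A root \<open>N / D\<close> of an unknown \<open>Q\<close> with coefficients \<open>q i\<close> means that the combination of the
  products \<open>D ^ (d - i) * N ^ i\<close> with coefficients \<open>q i\<close> vanishes. After clearing denominators these
  \<open>d + 1\<close> products lie in a lattice of rank \<open>d\<close>, so Siegel's lemma provides small \<open>q i\<close>.\<close>

lemma small_annihilating_poly_of_quotient:
  assumes N: "N \<in> int_span d \<alpha> X" and D: "D \<in> int_span d \<alpha> X" and D0: "D \<noteq> 0" and X: "X \<ge> 1"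
  obtains Q where "Q \<noteq> 0" "degree Q \<le> d" "ipoly Q (N / D) = 0"
    "\<And>i. \<bar>coeff Q i\<bar> \<le> int ((2 * (d + 1) * (mult_const * X) ^ d) ^ d)"
proof -
  define y where "y = (\<lambda>i. (of_int a ^ d) ^ d * D ^ (d - i) * N ^ i)"
  let ?T = "(mult_const * X) ^ d"
  have "\<exists>s. (\<forall>j<d. \<bar>s j\<bar> \<le> int ?T) \<and> y i = (\<Sum>j<d. of_int (s j) * \<alpha> ^ j)" if "i \<le> d" for i
    using int_span_power_mult[OF N D, of "d - i" i] that unfolding y_def int_span_def by simp
  then obtain s where s: "\<And>i j. i \<le> d \<Longrightarrow> j < d \<Longrightarrow> \<bar>s i j\<bar> \<le> int ?T"
    and ys: "\<And>i. i \<le> d \<Longrightarrow> y i = (\<Sum>j<d. of_int (s i j) * \<alpha> ^ j)" by metis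
  have "?T \<ge> 1" using X d_pos length_poly_pos[OF P0] by (simp add: mult_const_def)
  from small_integer_kernel_vector[of ?T d s, OF this s] obtain q :: "nat \<Rightarrow> int"
    where q0: "\<exists>i\<le>d. q i \<noteq> 0" and qb: "\<And>i. \<bar>q i\<bar> \<le> int ((2 * (d + 1) * ?T) ^ d)"
      and qs: "\<And>j. j < d \<Longrightarrow> (\<Sum>i\<le>d. q i * s i j) = 0" by blast
  define Q where "Q = (\<Sum>i\<le>d. monom (q i) i)"
  have cQ: "coeff Q i = (if i \<le> d then q i else 0)" for i
    unfolding Q_def by (simp add: coeff_sum)
  show thesis
  proof (rule that[of Q])
    show "Q \<noteq> 0" using q0 cQ by (metis coeff_0)
    show "degree Q \<le> d" by (rule degree_le) (simp add: cQ)
    show "\<bar>coeff Q i\<bar> \<le> int ((2 * (d + 1) * ?T) ^ d)" for i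
      using qb[of i] by (simp add: cQ)
    have "(\<Sum>i\<le>d. of_int (q i) * y i) = (\<Sum>i\<le>d. \<Sum>j<d. of_int (q i * s i j) * \<alpha> ^ j)"
      using ys by (simp add: sum_distrib_left mult.assoc)
    also have "\<dots> = (\<Sum>j<d. \<Sum>i\<le>d. of_int (q i * s i j) * \<alpha> ^ j)" by (rule sum.swap)
    also have "\<dots> = (\<Sum>j<d. of_int (\<Sum>i\<le>d. q i * s i j) * \<alpha> ^ j)"
      by (simp only: of_int_sum sum_distrib_right)
    also have "\<dots> = 0" using qs by simp
    finally have zero: "(\<Sum>i\<le>d. of_int (q i) * y i) = 0" .
    have yi: "y i = (of_int a ^ d) ^ d * D ^ d * (N / D) ^ i" if "i \<le> d" for i
      using D0 that by (simp add: y_def power_divide power_diff)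
    have "ipoly Q (N / D) = (\<Sum>i\<le>d. of_int (q i) * (N / D) ^ i)"
      unfolding Q_def of_int_poly_hom.hom_sum poly_sum
      by (simp add: map_poly_monom poly_monom)
    hence "(of_int a ^ d) ^ d * D ^ d * ipoly Q (N / D) = (\<Sum>i\<le>d. of_int (q i) * y i)"
      using yi by (simp add: sum_distrib_left ac_simps)
    with zero show "ipoly Q (N / D) = 0" using D0 P0 by simp
  qed
qed

definition height_const :: real where
  "height_const = ln (real ((d + 1) * (2 * (d + 1) * mult_const ^ d) ^ d))"

text \<open>The height of a quotient of lattice elements grows at most linearly in the logarithm of the
  size of their coordinates.\<close>

lemma log_height_quotient_le:
  assumes N: "N \<in> int_span d \<alpha> X" and D: "D \<in> int_span d \<alpha> X" and D0: "D \<noteq> 0" and X: "X \<ge> 1"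
  shows "log_height (N / D) \<le> height_const + real (d * d) * ln (real X)"
proof -
  obtain Q where Q: "Q \<noteq> 0" "degree Q \<le> d" "ipoly Q (N / D) = 0"
    and cQ: "\<And>i. \<bar>coeff Q i\<bar> \<le> int ((2 * (d + 1) * (mult_const * X) ^ d) ^ d)" (is "\<And>i. _ \<le> int ?H")
    using small_annihilating_poly_of_quotient[OF assms] by blast
  have mc: "mult_const \<ge> 1" using d_pos length_poly_pos[OF P0] by (simp add: mult_const_def)
  have "mahler_measure Q \<le> (\<Sum>i\<le>degree Q. \<bar>real_of_int (coeff Q i)\<bar>)" by (rule mahler_measure_le_sum_abs_coeffs)
  also have "\<dots> \<le> (\<Sum>i\<le>degree Q. real ?H)"
  proof (rule sum_mono)
    fix i
    have "real_of_int \<bar>coeff Q i\<bar> \<le> real_of_int (int ?H)" using cQ[of i] by (simp only: of_int_le_iff)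
    thus "\<bar>real_of_int (coeff Q i)\<bar> \<le> real ?H" by simp
  qed
  also have "\<dots> = real (degree Q + 1) * real ?H" by simp
  also have "\<dots> \<le> real (d + 1) * real ?H" using Q(2) by (intro mult_right_mono) auto
  also have "\<dots> = real ((d + 1) * (2 * (d + 1) * mult_const ^ d) ^ d) * real X ^ (d * d)"
  proof -
    have "(d + 1) * ?H = (d + 1) * (2 * (d + 1) * mult_const ^ d) ^ d * X ^ (d * d)"
      by (simp only: power_mult_distrib power_mult mult.assoc)
    hence "real ((d + 1) * ?H) = real ((d + 1) * (2 * (d + 1) * mult_const ^ d) ^ d * X ^ (d * d))"
      by (rule arg_cong)
    moreover have "real (X ^ (d * d)) = real X ^ (d * d)" by simp
    ultimately show ?thesis by (simp only: of_nat_mult[of _ "X ^ _"] of_nat_mult[of _ ?H])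
  qed
  finally have "mahler_measure Q \<le> real ((d + 1) * (2 * (d + 1) * mult_const ^ d) ^ d) * real X ^ (d * d)" .
  moreover have "0 < mahler_measure Q" using mahler_measure_poly_ge_1[OF Q(1)] by simp
  ultimately have "ln (mahler_measure Q) \<le> ln (real ((d + 1) * (2 * (d + 1) * mult_const ^ d) ^ d) * real X ^ (d * d))"
    by (subst ln_le_cancel_iff) auto
  also have "\<dots> = height_const + real (d * d) * ln (real X)"
  proof -
    have "(d + 1) * (2 * (d + 1) * mult_const ^ d) ^ d > 0" using mc by simp
    hence "real ((d + 1) * (2 * (d + 1) * mult_const ^ d) ^ d) > 0" by (simp only: of_nat_0_less_iff)
    thus ?thesis using X unfolding height_const_def by (subst ln_mult_pos) (simp_all add: ln_realpow)
  qed
  finally show ?thesis using log_height_le_ln_mahler_measure[OF Q(1,3)] by linarith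
qed

end

section \<open>Subfields of the complex numbers\<close>

lemma is_subfield_rat_adjoin: "is_subfield (rat_adjoin x)"
  unfolding rat_adjoin_def by (rule hull_in) (auto simp: is_subfield_def)

lemma rat_adjoin_gen: "x \<in> rat_adjoin x"
  unfolding rat_adjoin_def by (simp add: hull_inc)

context
  fixes K :: "complex set" assumes K: "is_subfield K"
begin

lemma subfield_0: "0 \<in> K" and subfield_1: "1 \<in> K"
  and subfield_add: "x \<in> K \<Longrightarrow> y \<in> K \<Longrightarrow> x + y \<in> K"
  and subfield_mult: "x \<in> K \<Longrightarrow> y \<in> K \<Longrightarrow> x * y \<in> K"
  and subfield_uminus: "x \<in> K \<Longrightarrow> - x \<in> K"
  and subfield_inverse: "x \<in> K \<Longrightarrow> inverse x \<in> K"
  using K unfolding is_subfield_def by blast+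

lemma subfield_sum: "(\<And>i. i \<in> I \<Longrightarrow> f i \<in> K) \<Longrightarrow> sum f I \<in> K"
  by (induction I rule: infinite_finite_induct) (simp_all add: subfield_0 subfield_add)

lemma subfield_power: "x \<in> K \<Longrightarrow> x ^ n \<in> K"
  by (induction n) (simp_all add: subfield_1 subfield_mult)

lemma subfield_of_int: "of_int n \<in> K"
proof -
  have "of_nat k \<in> K" for k by (induction k) (simp_all add: subfield_0 subfield_1 subfield_add)
  thus ?thesis by (cases n rule: int_cases2) (simp_all add: subfield_uminus)
qed

end

section \<open>The component of a linear recurrence along one root\<close>

text \<open>Irreducible polynomials have simple roots: the derivative has smaller degree, so it cannot be
  a multiple of \<open>p\<close>.\<close>

lemma ipoly_pderiv_nonzero:
  assumes "irreducible p" "ipoly p x = 0"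
  shows "ipoly (pderiv p) x \<noteq> 0"
proof
  assume "ipoly (pderiv p) x = 0"
  hence "p dvd pderiv p" by (rule irreducible_dvd_if_common_root[OF assms])
  moreover have "degree p > 0" using degree_pos_of_root[of p x] assms by auto
  moreover have "degree (pderiv p) = degree p - 1" by (rule degree_pderiv)
  moreover have "pderiv p \<noteq> 0" using \<open>degree p > 0\<close> by (simp add: pderiv_eq_0_iff)
  ultimately show False using dvd_imp_degree_le[of p "pderiv p"] by simp
qed

context algebraic_root
begin

text \<open>This is the operator \<open>G(shift)\<close>, where \<open>G\<close> is the quotient of \<open>P\<close> by \<open>X - \<alpha>\<close>, applied to a
  sequence. On solutions of the recurrence with characteristic polynomial \<open>P\<close> it kills the
  contributions of all conjugates of \<open>\<alpha>\<close> other than \<open>\<alpha>\<close> itself, so it reads off the coefficient of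
  \<open>\<alpha> ^ n\<close> from \<open>d\<close> consecutive terms.\<close>

definition alpha_part :: "(nat \<Rightarrow> complex) \<Rightarrow> nat \<Rightarrow> complex" where
  "alpha_part u n = (\<Sum>k\<le>d. of_int (coeff P k) * (\<Sum>i<k. \<alpha> ^ (k - 1 - i) * u (n + i)))"

text \<open>The factorization \<open>P = (X - \<alpha>) * G\<close> in terms of shifts: for each \<open>k\<close> the inner sums
  telescope to \<open>u (n + k) - \<alpha> ^ k * u n\<close>, and the second terms add up to a multiple of \<open>P(\<alpha>) = 0\<close>.\<close>

lemma alpha_part_Suc:
  "alpha_part u (Suc n) = \<alpha> * alpha_part u n + (\<Sum>k\<le>d. of_int (coeff P k) * u (n + k))"
proof -
  define S where "S = (\<lambda>k n. \<Sum>i<k. \<alpha> ^ (k - 1 - i) * u (n + i))"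
  have SS: "S (Suc k) n = \<alpha> * S k n + u (n + k)" for k n
  proof -
    have "\<alpha> ^ (k - i) = \<alpha> * \<alpha> ^ (k - 1 - i)" if "i < k" for i
    proof -
      have "k - i = Suc (k - 1 - i)" using that by simp
      thus ?thesis by (simp only: power_Suc)
    qed
    thus ?thesis by (simp add: S_def sum_distrib_left mult.assoc)
  qed
  have S: "S k (Suc n) = \<alpha> * S k n + (u (n + k) - \<alpha> ^ k * u n)" for k
  proof (induction k)
    case (Suc k)
    show ?case unfolding SS Suc.IH by (simp add: algebra_simps)
  qed (simp add: S_def)
  have "alpha_part u (Suc n) = (\<Sum>k\<le>d. of_int (coeff P k) * S k (Suc n))"
    by (simp add: alpha_part_def S_def)
  also have "\<dots> = (\<Sum>k\<le>d. \<alpha> * (of_int (coeff P k) * S k n) + of_int (coeff P k) * u (n + k)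
      - (of_int (coeff P k) * \<alpha> ^ k) * u n)"
    by (rule sum.cong) (simp_all add: S algebra_simps)
  also have "\<dots> = \<alpha> * (\<Sum>k\<le>d. of_int (coeff P k) * S k n) + (\<Sum>k\<le>d. of_int (coeff P k) * u (n + k))
      - (\<Sum>k\<le>d. of_int (coeff P k) * \<alpha> ^ k) * u n"
    by (simp only: sum_subtractf sum.distrib sum_distrib_left sum_distrib_right)
  finally show ?thesis by (simp add: root_sum alpha_part_def S_def)
qed

lemma alpha_part_recurrence:
  assumes "m \<le> n" "\<And>l. m \<le> l \<Longrightarrow> l < n \<Longrightarrow> (\<Sum>k\<le>d. of_int (coeff P k) * u (l + k)) = 0"
  shows "alpha_part u n = \<alpha> ^ (n - m) * alpha_part u m"
  using assms
proof (induction n rule: dec_induct)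
  case (step n)
  thus ?case by (simp add: alpha_part_Suc Suc_diff_le)
qed simp

lemma alpha_part_diff:
  "alpha_part (\<lambda>n. x * u n - w n) n = x * alpha_part u n - alpha_part w n"
  unfolding alpha_part_def
  by (simp add: right_diff_distrib sum_subtractf sum_distrib_left ac_simps)

text \<open>On the powers of \<open>\<alpha>\<close> the operator acts as multiplication by \<open>G(\<alpha>)\<close>, which is the value of
  the derivative of \<open>P\<close> at \<open>\<alpha>\<close>.\<close>

lemma alpha_part_geometric: "alpha_part (\<lambda>n. \<alpha> ^ n) n = \<alpha> ^ n * ipoly (pderiv P) \<alpha>"
proof -
  have "alpha_part (\<lambda>n. \<alpha> ^ n) n = \<alpha> ^ n * (\<Sum>k\<le>d. of_int (coeff P k) * (of_nat k * \<alpha> ^ (k - 1)))"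
    unfolding alpha_part_def
  proof (subst sum_distrib_left, rule sum.cong)
    fix k
    have "(\<Sum>i<k. \<alpha> ^ (k - 1 - i) * \<alpha> ^ (n + i)) = (\<Sum>i<k. \<alpha> ^ (n + (k - 1)))"
      by (rule sum.cong) (simp_all flip: power_add add: add.commute)
    also have "\<dots> = of_nat k * (\<alpha> ^ n * \<alpha> ^ (k - 1))"
      by (simp only: sum_constant card_lessThan power_add)
    finally show "of_int (coeff P k) * (\<Sum>i<k. \<alpha> ^ (k - 1 - i) * \<alpha> ^ (n + i))
        = \<alpha> ^ n * (of_int (coeff P k) * (of_nat k * \<alpha> ^ (k - 1)))"
      by (simp only: mult.left_commute)
  qed simp
  also have "(\<Sum>k\<le>d. of_int (coeff P k) * (of_nat k * \<alpha> ^ (k - 1))) = ipoly (pderiv P) \<alpha>"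
  proof -
    obtain e where e: "d = Suc e" using d_pos by (cases d) auto
    have "(\<Sum>k\<le>Suc e. of_int (coeff P k) * (of_nat k * \<alpha> ^ (k - 1)))
        = (\<Sum>k\<le>e. of_int (coeff (pderiv P) k) * \<alpha> ^ k)"
      by (simp add: sum.atMost_Suc_shift coeff_pderiv ac_simps del: sum.atMost_Suc)
    also have "\<dots> = ipoly (pderiv P) \<alpha>"
      using e by (simp add: poly_altdef degree_pderiv)
    finally show ?thesis unfolding e .
  qed
  finally show ?thesis .
qed

definition alpha_part_norm :: real where
  "alpha_part_norm = (\<Sum>k\<le>d. \<bar>of_int (coeff P k)\<bar> * (\<Sum>i<k. norm \<alpha> ^ (k - 1 - i)))"

lemma norm_alpha_part_le:
  assumes "\<And>n. norm (u n) \<le> B"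
  shows "norm (alpha_part u n) \<le> alpha_part_norm * B"
proof -
  have "norm (alpha_part u n) \<le> (\<Sum>k\<le>d. \<bar>of_int (coeff P k)\<bar> * (\<Sum>i<k. norm \<alpha> ^ (k - 1 - i) * B))"
    unfolding alpha_part_def
    by (intro sum_norm_le order_trans[OF norm_mult_ineq] mult_mono)
       (auto simp: norm_mult norm_power intro!: mult_left_mono assms sum_nonneg)
  thus ?thesis by (simp add: alpha_part_norm_def sum_distrib_right mult.assoc)
qed

lemma alpha_part_in_subfield:
  assumes "is_subfield K" "\<alpha> \<in> K" "\<And>n. u n \<in> K"
  shows "alpha_part u n \<in> K"
  unfolding alpha_part_def using assms
  by (intro subfield_sum subfield_mult subfield_of_int subfield_power)

lemma abs_coeff_le_length: "k \<le> d \<Longrightarrow> \<bar>coeff P k\<bar> \<le> int L"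
  using coeffs_le_length[of k] lead_le_length by (cases "k = d") auto

lemma alpha_part_in_int_span:
  assumes "\<And>i. i < d \<Longrightarrow> \<bar>u (n + i)\<bar> \<le> int X"
  shows "alpha_part (\<lambda>n. of_int (u n)) n \<in> int_span d \<alpha> ((d + 1) * L * (d * X))"
proof -
  have "(\<Sum>i<k. \<alpha> ^ (k - 1 - i) * of_int (u (n + i))) \<in> int_span d \<alpha> (d * X)" if k: "k \<le> d" for k
  proof -
    have "(\<Sum>i<k. of_int (u (n + i)) * \<alpha> ^ (k - 1 - i)) \<in> int_span d \<alpha> (card {..<k} * X * 1)"
      using k by (intro int_span_sum int_span_power) (auto intro!: assms)
    moreover have "card {..<k} * X * 1 \<le> d * X" using k by simp
    ultimately show ?thesis by (subst mult.commute) (rule int_span_mono)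
  qed
  hence "alpha_part (\<lambda>n. of_int (u n)) n \<in> int_span d \<alpha> (card {..d} * L * (d * X))"
    unfolding alpha_part_def by (intro int_span_sum) (auto intro: abs_coeff_le_length)
  thus ?thesis by simp
qed

lemma ipoly_pderiv_in_int_span: "ipoly (pderiv P) \<alpha> \<in> int_span d \<alpha> ((d + 1) * L * d)"
proof (rule int_spanI[of _ "coeff (pderiv P)"])
  fix j assume j: "j < d"
  have "\<bar>coeff (pderiv P) j\<bar> = int (Suc j) * \<bar>coeff P (Suc j)\<bar>"
    by (simp add: coeff_pderiv abs_mult)
  also have "\<dots> \<le> int (d + 1) * int L"
    using j by (intro mult_mono abs_coeff_le_length) auto
  also have "\<dots> = int ((d + 1) * L * 1)" by (simp only: of_nat_mult)
  also have "\<dots> \<le> int ((d + 1) * L * d)" using d_pos by (intro of_nat_mono mult_le_mono order_refl)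
  finally show "\<bar>coeff (pderiv P) j\<bar> \<le> int ((d + 1) * L * d)" .
next
  obtain e where e: "d = Suc e" using d_pos by (cases d) auto
  show "ipoly (pderiv P) \<alpha> = (\<Sum>j<d. of_int (coeff (pderiv P) j) * \<alpha> ^ j)"
    using e by (simp add: poly_altdef degree_pderiv lessThan_Suc_atMost)
qed

end

section \<open>Length of the blocks on which the recurrence holds\<close>

context algebraic_root
begin

text \<open>The approximation to \<open>\<xi>\<close> that an integer sequence determines at the place \<open>m\<close>, as a quotient
  of lattice elements. Numerator and denominator are both multiplied by \<open>a ^ m\<close>, since \<open>\<alpha> ^ m\<close> itself
  need not lie in the lattice.\<close>

lemma alpha_part_quotient:
  assumes u: "\<forall>i<d. \<bar>u (m + i)\<bar> \<le> int X" and X: "X \<ge> 1"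
    and nz: "\<alpha> \<noteq> 0" "ipoly (pderiv P) \<alpha> \<noteq> 0"
  obtains N D where "N \<in> int_span d \<alpha> ((d + 1) * d * L * L ^ m * X)"
    "D \<in> int_span d \<alpha> ((d + 1) * d * L * L ^ m * X)" "D \<noteq> 0"
    "alpha_part (\<lambda>n. of_int (u n)) m / (\<alpha> ^ m * ipoly (pderiv P) \<alpha>) = N / D"
proof -
  let ?Y = "(d + 1) * d * L * L ^ m * X"
  let ?N = "of_int (a ^ m) * alpha_part (\<lambda>n. of_int (u n)) m"
  let ?D = "of_int a ^ m * \<alpha> ^ m * ipoly (pderiv P) \<alpha>"
  have "\<bar>a ^ m\<bar> \<le> int (L ^ m)"
    using power_mono[OF lead_le_length, of m] by (simp add: power_abs)
  hence "?N \<in> int_span d \<alpha> (L ^ m * ((d + 1) * L * (d * X)))"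
    by (intro int_span_of_int_mult alpha_part_in_int_span u[rule_format])
  hence N: "?N \<in> int_span d \<alpha> ?Y" by (simp only: ac_simps)
  have "?D \<in> int_span d \<alpha> (L ^ m * ((d + 1) * L * d))"
    by (intro int_span_shift_power ipoly_pderiv_in_int_span)
  moreover have "L ^ m * ((d + 1) * L * d) \<le> ?Y"
  proof -
    have "L ^ m * ((d + 1) * L * d) = (d + 1) * d * L * L ^ m * 1" by (simp only: ac_simps mult_1_right)
    also have "\<dots> \<le> ?Y" using X by (intro mult_le_mono order_refl)
    finally show ?thesis .
  qed
  ultimately have D: "?D \<in> int_span d \<alpha> ?Y" by (rule int_span_mono[rotated])
  have "?D \<noteq> 0" using nz P0 by simp
  moreover have "alpha_part (\<lambda>n. of_int (u n)) m / (\<alpha> ^ m * ipoly (pderiv P) \<alpha>) = ?N / ?D"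
    using P0 by (simp add: mult.assoc)
  ultimately show thesis by (intro that[OF N D])
qed

text \<open>The failure of the Liouville property bounds the distance from \<open>\<xi>\<close> only to elements of
  positive height. The elements of height zero that occur here form a finite set because their
  degrees are bounded by \<open>d\<close>, so they stay away from \<open>\<xi>\<close>, which lies outside \<open>K\<close>.\<close>

lemma non_liouville_lower_bound:
  fixes \<xi> :: complex
  assumes \<xi>: "\<xi> \<notin> K" and \<tau>: "\<tau> > 0"
    and lb: "\<forall>\<beta>\<in>K. log_height \<beta> > 0 \<longrightarrow> cmod (\<xi> - \<beta>) \<ge> exp (- \<tau> * log_height \<beta>)"
  obtains F G where "F \<ge> 0" "G \<ge> 0"
    "\<And>X N D. X \<ge> 1 \<Longrightarrow> N \<in> int_span d \<alpha> X \<Longrightarrow> D \<in> int_span d \<alpha> X \<Longrightarrow> D \<noteq> 0 \<Longrightarrow> N / D \<in> K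
       \<Longrightarrow> cmod (\<xi> - N / D) \<ge> exp (- (F + G * ln (real X)))"
proof -
  define S where "S = {\<beta>. \<exists>q. q \<noteq> 0 \<and> degree q \<le> d \<and> ipoly q \<beta> = 0 \<and> log_height \<beta> \<le> 0}"
  define \<kappa> where "\<kappa> = Min (insert 1 ((\<lambda>\<beta>. cmod (\<xi> - \<beta>)) ` (S \<inter> K)))"
  have fin: "finite (insert 1 ((\<lambda>\<beta>. cmod (\<xi> - \<beta>)) ` (S \<inter> K)))"
    using finite_roots_log_height_nonpos[of d] by (simp add: S_def)
  have \<kappa>_pos: "\<kappa> > 0"
  proof -
    have "cmod (\<xi> - \<beta>) > 0" if "\<beta> \<in> K" for \<beta> using \<xi> that by auto
    thus ?thesis unfolding \<kappa>_def using fin by (subst Min_gr_iff) auto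
  qed
  define F where "F = max 0 (max (- ln \<kappa>) (\<tau> * height_const))"
  define G where "G = \<tau> * real (d * d)"
  show thesis
  proof (rule that[of F G])
    show "F \<ge> 0" by (simp add: F_def)
    show G: "G \<ge> 0" using \<tau> by (simp add: G_def)
    fix X :: nat and N D
    assume X: "X \<ge> 1" and ND: "N \<in> int_span d \<alpha> X" "D \<in> int_span d \<alpha> X" "D \<noteq> 0" and mem: "N / D \<in> K"
    let ?\<beta> = "N / D"
    have lnX: "ln (real X) \<ge> 0" using X by simp
    show "cmod (\<xi> - ?\<beta>) \<ge> exp (- (F + G * ln (real X)))"
    proof (cases "log_height ?\<beta> > 0")
      case True
      have "\<tau> * log_height ?\<beta> \<le> \<tau> * (height_const + real (d * d) * ln (real X))"
        using log_height_quotient_le[OF ND X] \<tau> by (intro mult_left_mono) auto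
      also have "\<dots> = \<tau> * height_const + G * ln (real X)" by (simp add: G_def algebra_simps)
      also have "\<dots> \<le> F + G * ln (real X)" by (simp add: F_def)
      finally have "exp (- (F + G * ln (real X))) \<le> exp (- \<tau> * log_height ?\<beta>)" by simp
      with lb[rule_format, OF mem True] show ?thesis by linarith
    next
      case False
      obtain Q where "Q \<noteq> 0" "degree Q \<le> d" "ipoly Q ?\<beta> = 0"
        using small_annihilating_poly_of_quotient[OF ND X] by metis
      with False have "?\<beta> \<in> S" unfolding S_def by (intro CollectI exI[of _ Q] conjI) auto
      hence "\<kappa> \<le> cmod (\<xi> - ?\<beta>)" unfolding \<kappa>_def using fin mem by (intro Min_le) auto
      moreover have "exp (- (F + G * ln (real X))) \<le> \<kappa>"
      proof -
        have "0 \<le> G * ln (real X)" using G lnX by simp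
        moreover have "- ln \<kappa> \<le> F" by (simp add: F_def)
        ultimately have "- (F + G * ln (real X)) \<le> ln \<kappa>" by linarith
        thus ?thesis using \<kappa>_pos by (metis exp_le_cancel_iff exp_ln)
      qed
      ultimately show ?thesis by linarith
    qed
  qed
qed

text \<open>Suppose that the integers \<open>u n\<close> close to \<open>\<xi> * \<alpha> ^ n\<close> satisfy the recurrence on the whole
  block from \<open>m\<close> to \<open>M = A * m\<close>. Then the part of \<open>u\<close> along \<open>\<alpha>\<close> is \<open>c * \<alpha> ^ n\<close> with a constant \<open>c\<close>
  in \<open>K\<close>, and comparing at the far end of the block shows that \<open>c\<close> is within a constant times
  the power of \<open>cmod \<alpha>\<close> with exponent \<open>- M\<close> of \<open>\<xi>\<close>. But \<open>c\<close> is determined by the terms near the beginning of the block, so its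
  height is linear in \<open>m\<close> and the distance is at least exponentially small in \<open>m\<close>. For large \<open>A\<close>
  the two bounds contradict each other.\<close>

lemma recurrence_breaks_in_geometric_blocks:
  fixes \<xi> :: complex
  assumes irr: "irreducible P" and \<alpha>: "cmod \<alpha> > 1"
    and K: "is_subfield K" "\<alpha> \<in> K" and \<xi>: "\<xi> \<notin> K" and \<tau>: "\<tau> > 0"
    and lb: "\<forall>\<beta>\<in>K. log_height \<beta> > 0 \<longrightarrow> cmod (\<xi> - \<beta>) \<ge> exp (- \<tau> * log_height \<beta>)"
  obtains A :: nat where "A \<ge> 1" "\<And>m u. m \<ge> 1 \<Longrightarrow> \<forall>n. cmod (\<xi> * \<alpha> ^ n - of_int (u n)) \<le> 2
      \<Longrightarrow> \<exists>n. m \<le> n \<and> n < A * m \<and> (\<Sum>k\<le>d. coeff P k * u (n + k)) \<noteq> 0"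
proof -
  obtain F G where F: "F \<ge> 0" and G: "G \<ge> 0" and FG:
    "\<And>X N D. X \<ge> 1 \<Longrightarrow> N \<in> int_span d \<alpha> X \<Longrightarrow> D \<in> int_span d \<alpha> X \<Longrightarrow> D \<noteq> 0 \<Longrightarrow> N / D \<in> K
       \<Longrightarrow> cmod (\<xi> - N / D) \<ge> exp (- (F + G * ln (real X)))"
    by (rule non_liouville_lower_bound[OF \<xi> \<tau> lb]) (rule that)
  have \<alpha>0: "\<alpha> \<noteq> 0" using \<alpha> by auto
  define g where "g = ipoly (pderiv P) \<alpha>"
  have g0: "g \<noteq> 0" unfolding g_def by (rule ipoly_pderiv_nonzero[OF irr root])
  \<comment> \<open>Integers with \<open>\<bar>u n\<bar> \<le> U * \<kappa> ^ n\<close>, as coordinates in the lattice are graded by natural numbers.\<close>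
  define \<kappa> where "\<kappa> = nat \<lceil>cmod \<alpha>\<rceil>"
  have \<kappa>: "cmod \<alpha> \<le> real \<kappa>" unfolding \<kappa>_def by linarith
  hence \<kappa>1: "\<kappa> \<ge> 1" using \<alpha> by linarith
  define U where "U = nat \<lceil>cmod \<xi> + 2\<rceil>"
  have U: "cmod \<xi> + 2 \<le> real U" unfolding U_def by linarith
  have U1: "U \<ge> 1"
  proof -
    have "real U \<ge> 1" using U norm_ge_zero[of \<xi>] by linarith
    thus ?thesis by simp
  qed
  have L1: "L \<ge> 1" by (rule length_poly_pos[OF P0])
  define B where "B = (d + 1) * d * L * (U * \<kappa> ^ d)"
  have B1: "B \<ge> 1" using d_pos L1 U1 \<kappa>1 by (simp add: B_def)
  \<comment> \<open>\<open>R * m\<close> bounds \<open>M * ln (cmod \<alpha>)\<close> for every block on which the recurrence holds.\<close>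
  define R where "R = ln (max 1 (alpha_part_norm * 2 / cmod g)) + F + G * ln (real B) + G * ln (real (L * \<kappa>))"
  define A where "A = nat \<lceil>R / ln (cmod \<alpha>)\<rceil> + 1"
  have ln\<alpha>: "ln (cmod \<alpha>) > 0" using \<alpha> by (rule ln_gt_zero)
  have A: "real A * ln (cmod \<alpha>) > R"
  proof -
    have "R / ln (cmod \<alpha>) < real A" unfolding A_def by linarith
    thus ?thesis using ln\<alpha> by (simp add: pos_divide_less_eq)
  qed
  show thesis
  proof (rule that[of A])
    show "A \<ge> 1" by (simp add: A_def)
    fix m :: nat and u :: "nat \<Rightarrow> int"
    assume m: "m \<ge> 1" and near: "\<forall>n. cmod (\<xi> * \<alpha> ^ n - of_int (u n)) \<le> 2"
    show "\<exists>n. m \<le> n \<and> n < A * m \<and> (\<Sum>k\<le>d. coeff P k * u (n + k)) \<noteq> 0"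
    proof (rule ccontr)
      assume no: "\<not> ?thesis"
      let ?u = "\<lambda>n. complex_of_int (u n)"
      define M where "M = A * m"
      have "m \<le> M" by (simp add: M_def A_def)
      have rec: "(\<Sum>k\<le>d. of_int (coeff P k) * ?u (n + k)) = 0" if "m \<le> n" "n < M" for n
      proof -
        have "(\<Sum>k\<le>d. coeff P k * u (n + k)) = 0" using no that by (auto simp: M_def)
        hence "complex_of_int (\<Sum>k\<le>d. coeff P k * u (n + k)) = 0" by simp
        thus ?thesis by simp
      qed
      define c where "c = alpha_part ?u m / (\<alpha> ^ m * g)"
      have cM: "alpha_part ?u M = c * (\<alpha> ^ M * g)"
      proof -
        have "alpha_part ?u M = \<alpha> ^ (M - m) * alpha_part ?u m"
          by (rule alpha_part_recurrence[OF \<open>m \<le> M\<close> rec])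
        also have "alpha_part ?u m = c * (\<alpha> ^ m * g)" using \<alpha>0 g0 by (simp add: c_def)
        also have "\<alpha> ^ (M - m) * (c * (\<alpha> ^ m * g)) = c * (\<alpha> ^ (M - m) * \<alpha> ^ m * g)" by (simp only: ac_simps)
        also have "\<alpha> ^ (M - m) * \<alpha> ^ m = \<alpha> ^ M" using \<open>m \<le> M\<close> by (simp flip: power_add)
        finally show ?thesis .
      qed
      have "(\<xi> - c) * (\<alpha> ^ M * g) = alpha_part (\<lambda>n. \<xi> * \<alpha> ^ n - ?u n) M"
        unfolding alpha_part_diff alpha_part_geometric cM g_def[symmetric] by (simp add: algebra_simps)
      hence bound: "cmod (\<xi> - c) * (cmod \<alpha> ^ M * cmod g) \<le> alpha_part_norm * 2"
        using norm_alpha_part_le[of "\<lambda>n. \<xi> * \<alpha> ^ n - ?u n" 2 M, OF near[rule_format]]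
        by (simp flip: norm_mult norm_power)
      have pos: "cmod \<alpha> ^ M > 0" using \<alpha>0 by simp
      from bound have up: "cmod (\<xi> - c) * cmod \<alpha> ^ M \<le> max 1 (alpha_part_norm * 2 / cmod g)"
        using g0 by (simp add: pos_le_divide_eq mult.assoc le_max_iff_disj)

      let ?X = "U * \<kappa> ^ (m + d)"
      have ub: "\<forall>i<d. \<bar>u (m + i)\<bar> \<le> int ?X"
      proof (intro allI impI)
        fix i assume i: "i < d"
        have "real_of_int \<bar>u (m + i)\<bar> = cmod (?u (m + i))" by simp
        also have "\<dots> \<le> cmod (\<xi> * \<alpha> ^ (m + i)) + 2"
          using near[rule_format, of "m + i"] norm_triangle_sub[of "?u (m + i)" "\<xi> * \<alpha> ^ (m + i)"]
          by (simp add: norm_minus_commute)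
        also have "\<dots> \<le> cmod \<xi> * real \<kappa> ^ (m + d) + 2 * real \<kappa> ^ (m + d)"
        proof (rule add_mono)
          have "cmod \<alpha> ^ (m + i) \<le> cmod \<alpha> ^ (m + d)" using \<alpha> i by (intro power_increasing) auto
          also have "\<dots> \<le> real \<kappa> ^ (m + d)" using \<kappa> by (intro power_mono) auto
          finally show "cmod (\<xi> * \<alpha> ^ (m + i)) \<le> cmod \<xi> * real \<kappa> ^ (m + d)"
            by (simp add: norm_mult norm_power mult_left_mono)
          show "2 \<le> 2 * real \<kappa> ^ (m + d)" using \<kappa>1 by simp
        qed
        also have "\<dots> = (cmod \<xi> + 2) * real \<kappa> ^ (m + d)" by (simp add: algebra_simps)
        also have "\<dots> \<le> real U * real \<kappa> ^ (m + d)" by (rule mult_right_mono[OF U]) simp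
        finally have "real_of_int \<bar>u (m + i)\<bar> \<le> real_of_int (int ?X)" by simp
        thus "\<bar>u (m + i)\<bar> \<le> int ?X" by (simp only: of_int_le_iff)
      qed
      have X1: "?X \<ge> 1" using U1 \<kappa>1 by simp
      let ?Y = "(d + 1) * d * L * L ^ m * ?X"
      have Y: "?Y = B * (L * \<kappa>) ^ m"
        by (simp only: B_def power_add power_mult_distrib ac_simps)
      have Y1: "?Y \<ge> 1" unfolding Y using B1 L1 \<kappa>1 by simp
      obtain N D where ND: "N \<in> int_span d \<alpha> ?Y" "D \<in> int_span d \<alpha> ?Y" "D \<noteq> 0"
          and c: "alpha_part ?u m / (\<alpha> ^ m * ipoly (pderiv P) \<alpha>) = N / D"
        by (rule alpha_part_quotient[OF ub X1 \<alpha>0 g0[unfolded g_def]]) (rule that)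
      have c: "c = N / D" unfolding c_def g_def by (rule c)
      have "c \<in> K"
      proof -
        have "alpha_part ?u m \<in> K" by (intro alpha_part_in_subfield K subfield_of_int)
        moreover have "\<alpha> ^ m * g \<in> K"
          unfolding g_def alpha_part_geometric[symmetric] by (intro alpha_part_in_subfield K subfield_power)
        ultimately show ?thesis unfolding c_def divide_inverse
          by (rule subfield_mult[OF K(1) _ subfield_inverse[OF K(1)]])
      qed
      hence "exp (- (F + G * ln (real ?Y))) \<le> cmod (\<xi> - c)"
        using FG[OF Y1 ND] unfolding c by simp
      hence "exp (- (F + G * ln (real ?Y))) * cmod \<alpha> ^ M \<le> cmod (\<xi> - c) * cmod \<alpha> ^ M"
        by (rule mult_right_mono) simp
      also note up
      finally have "ln (exp (- (F + G * ln (real ?Y))) * cmod \<alpha> ^ M) \<le> ln (max 1 (alpha_part_norm * 2 / cmod g))"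
        using pos by (subst ln_le_cancel_iff) auto
      hence "real M * ln (cmod \<alpha>) \<le> ln (max 1 (alpha_part_norm * 2 / cmod g)) + F + G * ln (real ?Y)"
        using pos \<alpha>0 by (simp only: ln_mult_pos exp_gt_zero ln_exp ln_realpow zero_less_norm_iff)
      also have "ln (real ?Y) = ln (real B) + real m * ln (real (L * \<kappa>))"
      proof -
        have "real B > 0" "real (L * \<kappa>) > 0" using B1 L1 \<kappa>1 by auto
        thus ?thesis unfolding Y of_nat_mult[of B] of_nat_power by (subst ln_mult_pos) (auto simp: ln_realpow)
      qed
      also have "ln (max 1 (alpha_part_norm * 2 / cmod g)) + F + G * (ln (real B) + real m * ln (real (L * \<kappa>)))
          \<le> real m * R"
      proof -
        have 1: "x \<le> real m * x" if "x \<ge> 0" for x using mult_right_mono[of 1 "real m" x] m that by simp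
        have "ln (max 1 (alpha_part_norm * 2 / cmod g)) \<ge> 0" by (rule ln_ge_zero) simp
        moreover have "G * ln (real B) \<ge> 0" using G B1 by simp
        ultimately show ?thesis
          using 1[of "ln (max 1 (alpha_part_norm * 2 / cmod g))"] 1[OF F] 1[of "G * ln (real B)"]
          unfolding R_def by (simp add: algebra_simps)
      qed
      finally have "real m * (real A * ln (cmod \<alpha>)) \<le> real m * R" by (simp add: M_def ac_simps)
      hence "real A * ln (cmod \<alpha>) \<le> R" using m by simp
      with A show False by linarith
    qed
  qed
qed

end

section \<open>Counting indices far from the integers\<close>

text \<open>An irreducible integer polynomial that vanishes at 1 divides \<open>X - 1\<close>, so its only root is 1.
  The lemma turns the hypothesis on \<open>\<eta>\<close> into \<open>\<bar>\<eta>\<bar> < 1\<close>, a bound that does not involve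
  \<open>\<eta>\<close>; this is why the constant in the count can be independent of \<open>\<eta>\<close>.\<close>

lemma L_tilde_pos:
  assumes x: "algebraic (x :: real)" and x1: "x \<noteq> 1"
  shows "L_tilde (of_real x) \<ge> 1"
proof -
  let ?p = "min_int_poly (complex_of_real x)"
  obtain q where "q \<noteq> 0" "ipoly q (of_real x) = 0" using algebraic_int_poly[OF x] .
  note p = min_int_poly[OF this]
  have "(\<Sum>j\<le>degree ?p. coeff ?p j) \<noteq> 0"
  proof
    assume "(\<Sum>j\<le>degree ?p. coeff ?p j) = 0"
    hence "of_int (\<Sum>j\<le>degree ?p. coeff ?p j) = (0 :: complex)" by (simp only: of_int_0)
    hence "ipoly ?p 1 = 0" by (simp add: poly_altdef)
    moreover have "ipoly [:-1, 1:] 1 = 0" by simp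
    ultimately have "?p dvd [:-1, 1:]" by (rule irreducible_dvd_if_common_root[OF p(1)])
    then obtain k where k: "[:-1, 1:] = ?p * k" by (rule dvdE)
    have "ipoly [:-1, 1:] (of_real x) = 0" unfolding k of_int_poly_hom.hom_mult poly_mult using p(3) by simp
    hence "complex_of_real (x - 1) = 0" by simp
    hence "x - 1 = 0" by (simp only: of_real_eq_0_iff)
    with x1 show False by simp
  qed
  thus ?thesis unfolding L_tilde_def by linarith
qed

text \<open>Since \<open>\<xi> * \<alpha> ^ n\<close> satisfies the recurrence, applying it to the nearest integers leaves only
  the contributions of \<open>\<eta>\<close> and of the errors. Together they have absolute value less than 1, and the
  result is an integer.\<close>

lemma recurrence_of_near_shifted:
  fixes \<alpha> \<eta> \<xi> \<delta> :: real
  assumes root: "(\<Sum>k\<le>degree p. of_int (coeff p k) * \<alpha> ^ k) = 0"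
    and near: "\<And>k. k \<le> degree p \<Longrightarrow> dist_nearest_int (\<xi> * \<alpha> ^ (n + k) - \<eta>) \<le> \<delta>"
    and small: "real_of_int \<bar>\<Sum>k\<le>degree p. coeff p k\<bar> * \<bar>\<eta>\<bar> + real (length_poly p) * \<delta> < 1"
  shows "(\<Sum>k\<le>degree p. coeff p k * round (\<xi> * \<alpha> ^ (n + k) - \<eta>)) = 0"
proof -
  let ?a = "\<lambda>k. real_of_int (coeff p k)"
  define u where "u = (\<lambda>n. round (\<xi> * \<alpha> ^ n - \<eta>))"
  define e where "e = (\<lambda>n. \<xi> * \<alpha> ^ n - \<eta> - of_int (u n))"
  have e: "\<bar>e (n + k)\<bar> \<le> \<delta>" if "k \<le> degree p" for k
    using near[OF that] by (simp add: e_def u_def dist_nearest_int_def)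
  have "(\<Sum>k\<le>degree p. ?a k * (\<xi> * \<alpha> ^ (n + k))) = \<xi> * \<alpha> ^ n * (\<Sum>k\<le>degree p. ?a k * \<alpha> ^ k)"
    unfolding sum_distrib_left by (simp add: power_add ac_simps)
  hence geo: "(\<Sum>k\<le>degree p. ?a k * (\<xi> * \<alpha> ^ (n + k))) = 0" by (simp add: root)
  have "(\<Sum>k\<le>degree p. ?a k * of_int (u (n + k)))
      = (\<Sum>k\<le>degree p. ?a k * (\<xi> * \<alpha> ^ (n + k)) - ?a k * \<eta> - ?a k * e (n + k))"
    by (rule sum.cong) (simp_all add: e_def algebra_simps)
  also have "\<dots> = - ((\<Sum>k\<le>degree p. ?a k) * \<eta>) - (\<Sum>k\<le>degree p. ?a k * e (n + k))"
    by (simp add: sum_subtractf geo sum_distrib_right)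
  finally have eq: "real_of_int (\<Sum>k\<le>degree p. coeff p k * u (n + k))
      = - ((\<Sum>k\<le>degree p. ?a k) * \<eta>) - (\<Sum>k\<le>degree p. ?a k * e (n + k))" by simp
  have "\<bar>\<Sum>k\<le>degree p. ?a k * e (n + k)\<bar> \<le> (\<Sum>k\<le>degree p. \<bar>?a k\<bar> * \<delta>)"
    by (rule order_trans[OF sum_abs]) (auto simp: abs_mult intro!: sum_mono mult_left_mono e)
  also have "\<dots> = real (length_poly p) * \<delta>"
    by (simp add: length_poly_def sum_distrib_right)
  finally have "\<bar>real_of_int (\<Sum>k\<le>degree p. coeff p k * u (n + k))\<bar>
      \<le> \<bar>(\<Sum>k\<le>degree p. ?a k) * \<eta>\<bar> + real (length_poly p) * \<delta>" unfolding eq by linarith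
  also have "\<bar>(\<Sum>k\<le>degree p. ?a k) * \<eta>\<bar> = real_of_int \<bar>\<Sum>k\<le>degree p. coeff p k\<bar> * \<bar>\<eta>\<bar>"
    by (simp add: abs_mult)
  also note small
  finally have "\<bar>\<Sum>k\<le>degree p. coeff p k * u (n + k)\<bar> < 1" by linarith
  thus ?thesis by (simp add: u_def)
qed

text \<open>The blocks from \<open>B ^ i + 1\<close> to \<open>B ^ (i + 1)\<close> are disjoint and each contains a solution; the
  number of them below \<open>N\<close> is the integer part of the logarithm of \<open>N\<close> to the base \<open>B\<close>.\<close>

lemma card_ge_log_of_geometric_blocks:
  fixes Q :: "nat \<Rightarrow> bool"
  assumes B: "B \<ge> 2" and Q: "\<And>m. m \<ge> 1 \<Longrightarrow> \<exists>n. m < n \<and> n \<le> B * m \<and> Q n" and N: "N \<ge> 1"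
  shows "int (card {n. 1 \<le> n \<and> n \<le> N \<and> Q n}) \<ge> \<lfloor>1 / ln (real B) * ln (real N)\<rfloor>"
proof -
  have fin: "finite {n. 1 \<le> n \<and> n \<le> M \<and> Q n}" for M by simp
  have pow: "k \<le> card {n. 1 \<le> n \<and> n \<le> B ^ k \<and> Q n}" for k
  proof (induction k)
    case (Suc k)
    obtain n where n: "B ^ k < n" "n \<le> B * B ^ k" "Q n" using Q[of "B ^ k"] B by auto
    have "Suc k \<le> card (insert n {n. 1 \<le> n \<and> n \<le> B ^ k \<and> Q n})" using Suc n fin by simp
    also have "\<dots> \<le> card {n. 1 \<le> n \<and> n \<le> B ^ Suc k \<and> Q n}"
    proof (rule card_mono[OF fin])
      have "B ^ k \<le> B ^ Suc k" using B by simp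
      thus "insert n {n. 1 \<le> n \<and> n \<le> B ^ k \<and> Q n} \<subseteq> {n. 1 \<le> n \<and> n \<le> B ^ Suc k \<and> Q n}"
        using n by auto
    qed
    finally show ?case .
  qed simp
  have lnB: "ln (real B) > 0" using B by simp
  define k where "k = nat \<lfloor>1 / ln (real B) * ln (real N)\<rfloor>"
  have "1 / ln (real B) * ln (real N) \<ge> 0" using lnB N by simp
  hence k: "int k = \<lfloor>1 / ln (real B) * ln (real N)\<rfloor>" by (simp add: k_def)
  hence "real k \<le> 1 / ln (real B) * ln (real N)" by linarith
  hence "real k * ln (real B) \<le> ln (real N)" using lnB by (simp add: pos_le_divide_eq)
  hence "ln (real (B ^ k)) \<le> ln (real N)" using B by (simp add: ln_realpow)
  hence "real (B ^ k) \<le> real N" using B N by (subst (asm) ln_le_cancel_iff) auto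
  hence "B ^ k \<le> N" by simp
  hence "{n. 1 \<le> n \<and> n \<le> B ^ k \<and> Q n} \<subseteq> {n. 1 \<le> n \<and> n \<le> N \<and> Q n}" by auto
  from card_mono[OF fin this] pow[of k] k show ?thesis by linarith
qed

text \<open>Any positive value smaller than 1/2 for which the length of the minimal polynomial times the
  threshold stays below \<open>1 - L_tilde \<alpha> * \<bar>\<eta>\<bar>\<close> would do.\<close>

definition gap_threshold :: "real \<Rightarrow> real \<Rightarrow> real" where
  "gap_threshold \<alpha> \<eta> = (1 - real_of_int (L_tilde (of_real \<alpha>)) * \<bar>\<eta>\<bar>)
     / (4 * real (length_poly (min_int_poly (of_real \<alpha>))))"

lemma far_index_in_geometric_blocks:
  fixes \<alpha> \<xi> :: real
  assumes \<alpha>: "\<alpha> > 1" and alg: "algebraic \<alpha>"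
    and \<xi>: "complex_of_real \<xi> \<notin> rat_adjoin (of_real \<alpha>)"
    and nl: "\<not> liouville_over (rat_adjoin (of_real \<alpha>)) \<xi>"
  obtains B :: nat where "B \<ge> 2"
    "\<And>\<eta> m. real_of_int (L_tilde (of_real \<alpha>)) * \<bar>\<eta>\<bar> < 1 \<Longrightarrow> m \<ge> 1 \<Longrightarrow>
       \<exists>n. m < n \<and> n \<le> B * m \<and> dist_nearest_int (\<xi> * \<alpha> ^ n - \<eta>) \<ge> gap_threshold \<alpha> \<eta>"
proof -
  let ?\<alpha> = "complex_of_real \<alpha>"
  let ?K = "rat_adjoin ?\<alpha>"
  define P where "P = min_int_poly ?\<alpha>"
  obtain q where "q \<noteq> 0" "ipoly q ?\<alpha> = 0" using algebraic_int_poly[OF alg] .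
  note minP = min_int_poly[OF this, folded P_def]
  have P0: "P \<noteq> 0" using minP(1) by auto
  interpret algebraic_root P ?\<alpha> by unfold_locales (fact P0, fact minP(3))
  obtain \<tau> where \<tau>: "\<tau> > 0"
    and lb: "\<forall>\<beta>\<in>?K. log_height \<beta> > 0 \<longrightarrow> cmod (of_real \<xi> - \<beta>) \<ge> exp (- \<tau> * log_height \<beta>)"
    using nl \<xi> unfolding liouville_over_def by (metis linorder_not_less)
  have "cmod ?\<alpha> > 1" using \<alpha> by simp
  then obtain A :: nat where A1: "A \<ge> 1" and A: "\<And>m u. m \<ge> 1 \<Longrightarrow> \<forall>n. cmod (of_real \<xi> * ?\<alpha> ^ n - of_int (u n)) \<le> 2
      \<Longrightarrow> \<exists>n. m \<le> n \<and> n < A * m \<and> (\<Sum>k\<le>d. coeff P k * u (n + k)) \<noteq> 0"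
    by (rule recurrence_breaks_in_geometric_blocks[OF minP(1) _ is_subfield_rat_adjoin rat_adjoin_gen \<xi> \<tau> lb]) (rule that)
  have rootR: "(\<Sum>k\<le>degree P. of_int (coeff P k) * \<alpha> ^ k) = 0"
  proof -
    have "complex_of_real (\<Sum>k\<le>degree P. of_int (coeff P k) * \<alpha> ^ k) = 0" using root_sum by simp
    thus ?thesis by (simp only: of_real_eq_0_iff)
  qed
  have L1: "L \<ge> 1" by (rule length_poly_pos[OF P0])
  show thesis
  proof (rule that[of "2 * (A + d)"])
    show "2 \<le> 2 * (A + d)" using A1 by simp
    fix \<eta> :: real and m :: nat
    assume \<eta>: "real_of_int (L_tilde ?\<alpha>) * \<bar>\<eta>\<bar> < 1" and m: "m \<ge> 1"
    define \<delta> where "\<delta> = gap_threshold \<alpha> \<eta>"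
    have \<delta>: "real L * \<delta> = (1 - real_of_int (L_tilde ?\<alpha>) * \<bar>\<eta>\<bar>) / 4"
      using L1 by (simp add: \<delta>_def gap_threshold_def P_def[symmetric])
    have Lt: "real_of_int (L_tilde ?\<alpha>) = real_of_int \<bar>\<Sum>k\<le>d. coeff P k\<bar>"
      by (simp add: L_tilde_def P_def)
    have small: "real_of_int \<bar>\<Sum>k\<le>d. coeff P k\<bar> * \<bar>\<eta>\<bar> + real L * \<delta> < 1"
    proof -
      have "t + (1 - t) / 4 < 1" if "t < 1" for t :: real using that by (simp add: field_simps)
      from this[OF \<eta>] show ?thesis unfolding \<delta> Lt[symmetric] .
    qed
    have "\<bar>\<eta>\<bar> \<le> real_of_int (L_tilde ?\<alpha>) * \<bar>\<eta>\<bar>"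
      using mult_right_mono[of 1 "real_of_int (L_tilde ?\<alpha>)" "\<bar>\<eta>\<bar>"] L_tilde_pos[OF alg] \<alpha> by simp
    hence \<eta>1: "\<bar>\<eta>\<bar> < 1" using \<eta> by linarith
    define u where "u = (\<lambda>n. round (\<xi> * \<alpha> ^ n - \<eta>))"
    have near: "cmod (of_real \<xi> * ?\<alpha> ^ n - of_int (u n)) \<le> 2" for n
    proof -
      have "\<bar>of_int (u n) - (\<xi> * \<alpha> ^ n - \<eta>)\<bar> \<le> 1 / 2" unfolding u_def by (rule of_int_round_abs_le)
      hence "\<bar>\<xi> * \<alpha> ^ n - of_int (u n)\<bar> \<le> 2" using \<eta>1 by linarith
      moreover have "of_real \<xi> * ?\<alpha> ^ n - of_int (u n) = of_real (\<xi> * \<alpha> ^ n - of_int (u n))" by simp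
      ultimately show ?thesis by (simp only: norm_of_real)
    qed
    \<comment> \<open>Starting at \<open>m + 1\<close> gives an index strictly beyond \<open>m\<close>; as \<open>m + 1 \<le> 2 * m\<close>, the price is the factor 2.\<close>
    have "m + 1 \<ge> 1" by simp
    from A[of "m + 1" u, OF this] near obtain n where n: "m + 1 \<le> n" "n < A * (m + 1)"
      and nz: "(\<Sum>k\<le>d. coeff P k * u (n + k)) \<noteq> 0" by blast
    have "\<exists>k\<le>d. dist_nearest_int (\<xi> * \<alpha> ^ (n + k) - \<eta>) \<ge> \<delta>"
    proof (rule ccontr)
      assume "\<not> ?thesis"
      hence "\<And>k. k \<le> d \<Longrightarrow> dist_nearest_int (\<xi> * \<alpha> ^ (n + k) - \<eta>) \<le> \<delta>" by force
      from recurrence_of_near_shifted[OF rootR this small] nz show False unfolding u_def by simp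
    qed
    then obtain k where k: "k \<le> d" "dist_nearest_int (\<xi> * \<alpha> ^ (n + k) - \<eta>) \<ge> \<delta>" by blast
    have "n + k \<le> 2 * (A + d) * m"
    proof -
      have "A * (m + 1) \<le> A * (2 * m)" using m by (intro mult_le_mono) auto
      moreover have "d * 1 \<le> d * (2 * m)" using m by (intro mult_le_mono) auto
      ultimately have "n + k \<le> A * (2 * m) + d * (2 * m)" using n k by linarith
      thus ?thesis by (simp add: algebra_simps)
    qed
    thus "\<exists>n. m < n \<and> n \<le> 2 * (A + d) * m \<and> dist_nearest_int (\<xi> * \<alpha> ^ n - \<eta>) \<ge> gap_threshold \<alpha> \<eta>"
      using n k unfolding \<delta>_def by (intro exI[of _ "n + k"]) auto
  qed
qed

theorem theorem1p4:
  shows "\<exists>(\<delta>\<^sub>2 :: real \<Rightarrow> real \<Rightarrow> real) (C :: real \<Rightarrow> real \<Rightarrow> real).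
    \<forall>\<alpha> \<eta> \<xi> :: real.
      \<alpha> > 1 \<longrightarrow> algebraic \<alpha> \<longrightarrow>
      real_of_int (L_tilde (complex_of_real \<alpha>)) * \<bar>\<eta>\<bar> < 1 \<longrightarrow>
      complex_of_real \<xi> \<notin> rat_adjoin (complex_of_real \<alpha>) \<longrightarrow>
      \<not> liouville_over (rat_adjoin (complex_of_real \<alpha>)) \<xi> \<longrightarrow>
      \<delta>\<^sub>2 \<alpha> \<eta> \<in> {0<..<1/2} \<and> C \<alpha> \<xi> > 0 \<and>
      (\<forall>N::nat. N \<ge> 1 \<longrightarrow>
        int (card {n::nat. 1 \<le> n \<and> n \<le> N \<and> dist_nearest_int (\<xi> * \<alpha> ^ n - \<eta>) \<ge> \<delta>\<^sub>2 \<alpha> \<eta>})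
          \<ge> \<lfloor>C \<alpha> \<xi> * ln (real N)\<rfloor>)"
proof -
  define blocks where "blocks = (\<lambda>\<alpha> \<xi> B. B \<ge> (2 :: nat) \<and>
    (\<forall>\<eta> m. real_of_int (L_tilde (complex_of_real \<alpha>)) * \<bar>\<eta>\<bar> < 1 \<longrightarrow> m \<ge> 1 \<longrightarrow>
       (\<exists>n. m < n \<and> n \<le> B * m \<and> dist_nearest_int (\<xi> * \<alpha> ^ n - \<eta>) \<ge> gap_threshold \<alpha> \<eta>)))"
  \<comment> \<open>The base is chosen for all \<open>\<eta>\<close> at once, so that it is a function of \<open>\<alpha>\<close> and \<open>\<xi>\<close> only.\<close>
  define B where "B = (\<lambda>\<alpha> \<xi>. SOME B. blocks \<alpha> \<xi> B)"
  show ?thesis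
  proof (rule exI[of _ gap_threshold], rule exI[of _ "\<lambda>\<alpha> \<xi>. 1 / ln (real (B \<alpha> \<xi>))"], intro allI impI)
    fix \<alpha> \<eta> \<xi> :: real
    assume \<alpha>: "\<alpha> > 1" and alg: "algebraic \<alpha>"
      and \<eta>: "real_of_int (L_tilde (complex_of_real \<alpha>)) * \<bar>\<eta>\<bar> < 1"
      and \<xi>: "complex_of_real \<xi> \<notin> rat_adjoin (complex_of_real \<alpha>)"
      and nl: "\<not> liouville_over (rat_adjoin (complex_of_real \<alpha>)) \<xi>"
    have "\<exists>B. blocks \<alpha> \<xi> B"
      using far_index_in_geometric_blocks[OF \<alpha> alg \<xi> nl] unfolding blocks_def by metis
    hence "blocks \<alpha> \<xi> (B \<alpha> \<xi>)" unfolding B_def by (rule someI_ex)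
    hence B2: "B \<alpha> \<xi> \<ge> 2" and far: "\<And>m. m \<ge> 1 \<Longrightarrow>
       \<exists>n. m < n \<and> n \<le> B \<alpha> \<xi> * m \<and> dist_nearest_int (\<xi> * \<alpha> ^ n - \<eta>) \<ge> gap_threshold \<alpha> \<eta>"
      using \<eta> unfolding blocks_def by simp_all
    obtain q where "q \<noteq> 0" "ipoly q (of_real \<alpha>) = 0" using algebraic_int_poly[OF alg] .
    from min_int_poly(1)[OF this] have "min_int_poly (complex_of_real \<alpha>) \<noteq> 0" by auto
    hence L: "real (length_poly (min_int_poly (complex_of_real \<alpha>))) \<ge> 1" (is "?L \<ge> 1")
      using length_poly_pos by fastforce
    have "real_of_int (L_tilde (complex_of_real \<alpha>)) * \<bar>\<eta>\<bar> \<ge> 0" by (simp add: L_tilde_def)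
    hence "gap_threshold \<alpha> \<eta> \<le> 1 / (4 * 1)"
      unfolding gap_threshold_def using L by (intro frac_le) auto
    moreover have "gap_threshold \<alpha> \<eta> > 0" using \<eta> L by (simp add: gap_threshold_def)
    ultimately have "gap_threshold \<alpha> \<eta> \<in> {0<..<1/2}" by simp
    moreover have "1 / ln (real (B \<alpha> \<xi>)) > 0" using B2 by simp
    ultimately show "gap_threshold \<alpha> \<eta> \<in> {0<..<1/2} \<and> 1 / ln (real (B \<alpha> \<xi>)) > 0 \<and>
      (\<forall>N::nat. N \<ge> 1 \<longrightarrow>
        int (card {n::nat. 1 \<le> n \<and> n \<le> N \<and> dist_nearest_int (\<xi> * \<alpha> ^ n - \<eta>) \<ge> gap_threshold \<alpha> \<eta>})
          \<ge> \<lfloor>1 / ln (real (B \<alpha> \<xi>)) * ln (real N)\<rfloor>)"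
      using card_ge_log_of_geometric_blocks[OF B2 far] by blast
  qed
qed

end
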